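(* Let $\mathcal{D}$ be a distribution on $\mathbb{R}^d$, $f$ a linear threshold function on $\mathbb{R}^d$, $q\ge2$ and $k\in\{1,\dots,q-1\}$, and let $\mathcal{M}$ be a collection of $m$ bags sampled i.i.d. from $\mathrm{Ex}(f,\mathcal{D},q,k)$. There is an absolute constant $C_0>0$ such that for any $\varepsilon<1/(4q)$ and $\delta>0$, if $m\ge C_0d(\log q+\log(1/\delta))/\varepsilon^2$, then with probability at least $1-\delta$ over $\mathcal{M}$, every linear threshold function $h$ on $\mathbb{R}^d$ with $\mathrm{BagErr}_{\mathrm{sample}}(h,\mathcal{M})\le\varepsilon$ satisfies: (i) if $k\neq q/2$, $\Pr_{\mathbf{x}\sim\mathcal{D}}[f(\mathbf{x})\neq h(\mathbf{x})]\le4\varepsilon$; and (ii) if $k=q/2$, $\Pr_{\mathbf{x}\sim\mathcal{D}}[f(\mathbf{x})\neq h(\mathbf{x})]\le4\varepsilon$ or $\Pr_{\mathbf{x}\sim\mathcal{D}}[f(\mathbf{x})\neq1-h(\mathbf{x})]\le4\varepsilon$.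
   Context: A linear threshold function (LTF) is $\mathbf{x}\mapsto\mathrm{pos}(\mathbf{r}^{\mathsf T}\mathbf{x}+c)$ with $\mathrm{pos}(a)=1$ if $a>0$ and $0$ otherwise. The bag oracle $\mathrm{Ex}(f,\mathcal{D},q,k)$ returns a bag $B=\{\mathbf{x}^{(1)},\dots,\mathbf{x}^{(q)}\}$ of independent points with $\mathbf{x}^{(i)}\sim\mathcal{D}_{f,1}$ for $i\le k$ and $\mathbf{x}^{(i)}\sim\mathcal{D}_{f,0}$ for $i>k$, where $\mathcal{D}_{f,a}$ is $\mathcal{D}$ conditioned on $f(\mathbf{x})=a$ (both events assumed to have positive probability). For a hypothesis $h$ and a collection $\mathcal{M}$ of $m$ bags, $\mathrm{BagErr}_{\mathrm{sample}}(h,\mathcal{M}):=|\{B\in\mathcal{M}:\mathrm{Avg}\{h(\mathbf{x}):\mathbf{x}\in B\}\neq k/q\}|/m$. *)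

theory Defs
  imports "HOL-Probability.Probability"
begin

text \<open>Points of R^d are represented as functions nat => real; only the
  coordinates 0..<d are relevant (the measurable space is PiM {..<d} borel).\<close>

definition pos :: "real \<Rightarrow> real" where
  "pos a = (if a > 0 then 1 else 0)"

definition ltf :: "nat \<Rightarrow> ((nat \<Rightarrow> real) \<Rightarrow> real) set" where
  "ltf d = {h. \<exists>(r::nat \<Rightarrow> real) (c::real).
              \<forall>x. h x = pos ((\<Sum>i<d. r i * x i) + c)}"

definition cond_dist :: "(nat \<Rightarrow> real) measure \<Rightarrow> ((nat \<Rightarrow> real) \<Rightarrow> real) \<Rightarrow> real
    \<Rightarrow> (nat \<Rightarrow> real) measure" where
  "cond_dist D f a = uniform_measure D {x \<in> space D. f x = a}"

definition bag_dist :: "(nat \<Rightarrow> real) measure \<Rightarrow> ((nat \<Rightarrow> real) \<Rightarrow> real) \<Rightarrow> nat \<Rightarrow> nat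
    \<Rightarrow> (nat \<Rightarrow> (nat \<Rightarrow> real)) measure" where
  "bag_dist D f q k = (\<Pi>\<^sub>M i\<in>{..<q}. (if i < k then cond_dist D f 1 else cond_dist D f 0))"

definition sample_dist :: "(nat \<Rightarrow> real) measure \<Rightarrow> ((nat \<Rightarrow> real) \<Rightarrow> real) \<Rightarrow> nat \<Rightarrow> nat
    \<Rightarrow> nat \<Rightarrow> (nat \<Rightarrow> nat \<Rightarrow> (nat \<Rightarrow> real)) measure" where
  "sample_dist D f q k m = (\<Pi>\<^sub>M j\<in>{..<m}. bag_dist D f q k)"

definition bag_err :: "nat \<Rightarrow> nat \<Rightarrow> nat \<Rightarrow> ((nat \<Rightarrow> real) \<Rightarrow> real)
    \<Rightarrow> (nat \<Rightarrow> nat \<Rightarrow> (nat \<Rightarrow> real)) \<Rightarrow> real" where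
  "bag_err q k m h M =
     real (card {j \<in> {..<m}. (\<Sum>i<q. h (M j i)) / real q \<noteq> real k / real q}) / real m"

end

theory Submission
  imports Defs
begin

text \<open>Let \<open>p\<close> and \<open>r\<close> be the probabilities that \<open>h\<close> errs on a positive and on a negative point. A bag is
  labelled consistently by \<open>h\<close> iff the numbers of errors of the two kinds agree; these are independent
  binomial variables. Agreement with probability above \<open>1/2\<close> forces both variables to
  concentrate on one common value, and a binomial law gives no interior value more than \<open>1/2\<close>. So
  either \<open>p\<close> and \<open>r\<close> are both small, or both are close to \<open>1\<close> and \<open>k = q - k\<close>.

  It remains to see that a sample error of at most \<open>\<epsilon>\<close> implies a true bag error of at most \<open>4 \<epsilon>\<close>, uniformly
  in \<open>h\<close>. This is a relative deviation bound of Vapnik-Chervonenkis type, obtained from a ghost sample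
  and random swaps; its failure probability decays like \<open>exp (- c \<epsilon> m)\<close>, with \<open>\<epsilon>\<close> instead of \<open>\<epsilon>\<^sup>2\<close>, and this
  gain absorbs the factor \<open>log (1/\<epsilon>)\<close> that the union bound over the traces costs. Measurability of the
  bad event comes from threshold functions with rational coefficients, which are pointwise dense.\<close>

section \<open>Traces of linear threshold functions\<close>

definition shatters :: "'a set set \<Rightarrow> 'a set \<Rightarrow> bool" where
  "shatters F S \<longleftrightarrow> (\<forall>T\<subseteq>S. \<exists>A\<in>F. A \<inter> S = T)"

text \<open>Pajor's strengthening of the Sauer-Shelah lemma. Removing \<open>x\<close> splits
  \<open>F\<close> into two families on \<open>X\<close>, whose sizes add up as those of their union
  and intersection. What the union shatters, \<open>F\<close> shatters; what the intersection
  shatters, \<open>F\<close> shatters even with \<open>x\<close> added, so no shattered set is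
  counted twice.\<close>

lemma card_le_card_shattered:
  assumes "finite X" "F \<subseteq> Pow X"
  shows "card F \<le> card {S. S \<subseteq> X \<and> shatters F S}"
  using assms
proof (induction X arbitrary: F rule: finite_induct)
  case empty
  then have "F = {} \<or> F = {{}}" by auto
  moreover have "{S. S \<subseteq> {} \<and> shatters {{}} S} = {{} :: 'a set}" by (auto simp: shatters_def)
  ultimately show ?case by (elim disjE) simp_all
next
  case (insert x X)
  define Fa where "Fa = {A \<in> F. x \<notin> A}"
  define Fb where "Fb = (\<lambda>A. A - {x}) ` {A \<in> F. x \<in> A}"
  let ?Sh = "\<lambda>X F. {S. S \<subseteq> X \<and> shatters F S}"
  have finF: "finite F" 
    using insert.hyps by (intro finite_subset[OF insert.prems]) simp
  have "inj_on (\<lambda>A. A - {x}) {A \<in> F. x \<in> A}"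
    by (rule inj_onI) auto
  then have "card Fb = card {A \<in> F. x \<in> A}"
    by (simp add: Fb_def card_image)
  moreover have "card F = card Fa + card {A \<in> F. x \<in> A}"
  proof -
    have "card (Fa \<union> {A \<in> F. x \<in> A}) = card Fa + card {A \<in> F. x \<in> A}"
      using finF by (intro card_Un_disjoint) (auto simp: Fa_def)
    moreover have "Fa \<union> {A \<in> F. x \<in> A} = F" by (auto simp: Fa_def)
    ultimately show ?thesis by simp
  qed
  ultimately have "card F = card (Fa \<union> Fb) + card (Fa \<inter> Fb)"
    using finF card_Un_Int[of Fa Fb] by (simp add: Fa_def Fb_def)
  also have "\<dots> \<le> card (?Sh X (Fa \<union> Fb)) + card (?Sh X (Fa \<inter> Fb))"
    using insert.prems by (intro add_mono insert.IH) (auto simp: Fa_def Fb_def)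
  also have "card (?Sh X (Fa \<inter> Fb)) = card (insert x ` ?Sh X (Fa \<inter> Fb))"
    using insert.hyps by (intro card_image[symmetric] inj_onI) (metis (lifting) insert_ident mem_Collect_eq subsetD)
  also have "card (?Sh X (Fa \<union> Fb)) + card (insert x ` ?Sh X (Fa \<inter> Fb))
      = card (?Sh X (Fa \<union> Fb) \<union> insert x ` ?Sh X (Fa \<inter> Fb))"
    using insert.hyps by (intro card_Un_disjoint[symmetric]) auto
  also have "\<dots> \<le> card (?Sh (insert x X) F)"
  proof (intro card_mono)
    show "finite (?Sh (insert x X) F)" using insert.hyps by auto
    have "shatters F S" if S: "S \<subseteq> X" "shatters (Fa \<union> Fb) S" for S
      unfolding shatters_def
    proof (intro allI impI)
      fix T assume "T \<subseteq> S"
      with S obtain A where A: "A \<in> Fa \<union> Fb" "A \<inter> S = T" unfolding shatters_def by blast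
      then consider "A \<in> F" | A' where "A' \<in> F" "A = A' - {x}" by (auto simp: Fa_def Fb_def)
      then show "\<exists>A\<in>F. A \<inter> S = T" using A S insert.hyps by cases blast+
    qed
    moreover have "shatters F (insert x S)" if S: "S \<subseteq> X" "shatters (Fa \<inter> Fb) S" for S
      unfolding shatters_def
    proof (intro allI impI)
      fix T assume T: "T \<subseteq> insert x S"
      then have "T - {x} \<subseteq> S" by blast
      with S obtain A where A: "A \<in> Fa" "A \<in> Fb" "A \<inter> S = T - {x}" unfolding shatters_def by blast
      then obtain A' where A': "A' \<in> F" "x \<in> A'" "A = A' - {x}" by (auto simp: Fb_def)
      show "\<exists>A\<in>F. A \<inter> insert x S = T"
      proof (cases "x \<in> T")
        case True
        then show ?thesis using A A' T by (intro bexI[of _ A']) auto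
      next
        case False
        then show ?thesis using A A' T by (intro bexI[of _ A]) (auto simp: Fa_def)
      qed
    qed
    ultimately show "?Sh X (Fa \<union> Fb) \<union> insert x ` ?Sh X (Fa \<inter> Fb) \<subseteq> ?Sh (insert x X) F"
      by auto
  qed
  finally show ?case .
qed

text \<open>The free parameter \<open>t\<close> is chosen in terms of the accuracy rather than optimised, which keeps
  the logarithm of the sample size out of the final estimate.\<close>

lemma card_subsets_le_exp:
  fixes t :: real
  assumes X: "finite X" "card X \<le> N" and t: "0 < t" "t \<le> 1"
  shows "real (card {S. S \<subseteq> X \<and> card S \<le> n}) \<le> exp (t * real N) / t ^ n"
proof -
  let ?Y = "{S. S \<subseteq> X \<and> card S \<le> n}"
  have "real (card ?Y) * t ^ n = (\<Sum>S\<in>?Y. t ^ n)" by simp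
  \<comment> \<open>Since \<open>t \<le> 1\<close>, every small subset has weight at least
    \<open>t ^ n\<close>; summed over all subsets the weights form a binomial expansion.\<close>
  also have "\<dots> \<le> (\<Sum>S\<in>?Y. t ^ card S)"
    using t by (intro sum_mono power_decreasing) auto
  also have "\<dots> \<le> (\<Sum>S\<in>Pow X. t ^ card S)"
    using X t by (intro sum_mono2) auto
  also have "\<dots> = (1 + t) ^ card X"
    using prod_add[of X "\<lambda>_. t" "\<lambda>_. 1"] X by (simp add: add.commute)
  also have "\<dots> \<le> exp t ^ card X"
    using t by (intro power_mono) auto
  also have "\<dots> \<le> exp (t * real N)"
    using X t by (simp flip: exp_of_nat_mult add: mult.commute)
  finally show ?thesis using t by (simp add: field_simps)
qed

text \<open>Gaussian elimination: more vectors than coordinates are linearly dependent. A pivot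
  \<open>t\<close> clears the last coordinate of the other vectors, and a relation among the reduced
  vectors extends to \<open>t\<close>.\<close>

lemma exists_linear_relation:
  fixes v :: "'s \<Rightarrow> nat \<Rightarrow> real"
  assumes "finite S" "n < card S"
  shows "\<exists>a. (\<exists>s\<in>S. a s \<noteq> 0) \<and> (\<forall>i<n. (\<Sum>s\<in>S. a s * v s i) = 0)"
  using assms
proof (induction n arbitrary: S v)
  case 0
  then obtain s where "s \<in> S" by fastforce
  then show ?case by (intro exI[of _ "\<lambda>_. 1"]) auto
next
  case (Suc n)
  show ?case
  proof (cases "\<forall>s\<in>S. v s n = 0")
    case True
    obtain a where "\<exists>s\<in>S. a s \<noteq> 0" "\<forall>i<n. (\<Sum>s\<in>S. a s * v s i) = 0"
      using Suc.IH[of S v] Suc.prems by auto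
    then show ?thesis using True by (intro exI[of _ a]) (auto simp: less_Suc_eq)
  next
    case False
    then obtain t where t: "t \<in> S" "v t n \<noteq> 0" by auto
    define w where "w s i = v s i - v s n / v t n * v t i" for s i
    obtain b where b: "\<exists>s\<in>S-{t}. b s \<noteq> 0" "\<forall>i<n. (\<Sum>s\<in>S-{t}. b s * w s i) = 0"
      using Suc.IH[of "S - {t}" w] Suc.prems t by (auto simp: less_diff_conv)
    \<comment> \<open>The coefficient of the pivot collects the multiples of \<open>v t\<close> that
      were subtracted in forming \<open>w\<close>.\<close>
    define a where "a = b(t := - (\<Sum>s\<in>S-{t}. b s * v s n) / v t n)"
    have *: "(\<Sum>s\<in>S. a s * v s i) = (\<Sum>s\<in>S-{t}. b s * w s i)" for i
    proof -
      have "(\<Sum>s\<in>S. a s * v s i) = a t * v t i + (\<Sum>s\<in>S-{t}. b s * v s i)"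
        using Suc.prems t by (subst sum.remove[of _ t]) (auto simp: a_def intro!: sum.cong)
      also have "\<dots> = (\<Sum>s\<in>S-{t}. b s * v s i - b s * v s n / v t n * v t i)"
        by (simp add: a_def sum_subtractf sum_divide_distrib sum_distrib_right)
      finally show ?thesis by (simp add: w_def algebra_simps)
    qed
    have "w s n = 0" for s using t by (simp add: w_def)
    then have "\<forall>i<Suc n. (\<Sum>s\<in>S. a s * v s i) = 0"
      using b(2) by (auto simp: * less_Suc_eq)
    moreover have "\<exists>s\<in>S. a s \<noteq> 0" using b(1) by (auto simp: a_def)
    ultimately show ?thesis by blast
  qed
qed

text \<open>Radon's argument: \<open>d + 2\<close> points satisfy a nontrivial affine relation. A
  threshold function that is 1 exactly on the points with positive coefficient would make the
  weighted sum of its affine form positive, but the relation makes that sum vanish.\<close>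

lemma card_shattered_by_ltf:
  assumes "finite S" and sh: "shatters ((\<lambda>h. {x\<in>X. h x = 1}) ` ltf d) S"
  shows "card S \<le> Suc d"
proof (rule ccontr)
  assume "\<not> card S \<le> Suc d"
  \<comment> \<open>The extra coordinate with constant value 1 forces the coefficients to sum to
    zero, so the relation is affine.\<close>
  then obtain a where a: "\<exists>s\<in>S. a s \<noteq> 0"
     "\<forall>i<Suc d. (\<Sum>s\<in>S. a s * (if i < d then s i else 1)) = 0"
    using exists_linear_relation[of S "Suc d" "\<lambda>s i. if i < d then s i else 1"] assms by auto
  have a1: "(\<Sum>s\<in>S. a s) = 0" using a(2)[rule_format, of d] by simp
  have ai: "(\<Sum>s\<in>S. a s * s i) = 0" if "i < d" for i using a(2)[rule_format, of i] that by simp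
  obtain s0 where s0: "s0 \<in> S" "a s0 > 0"
  proof -
    have "\<exists>s\<in>S. a s > 0"
    proof (rule ccontr)
      assume "\<not> ?thesis"
      then have "\<forall>s\<in>S. a s = 0"
        using sum_nonneg_eq_0_iff[of S "\<lambda>s. - a s"] assms(1) a1 by (force simp: sum_negf)
      then show False using a(1) by blast
    qed
    then show ?thesis using that by blast
  qed
  have "\<exists>A\<in>(\<lambda>h. {x\<in>X. h x = 1}) ` ltf d. A \<inter> S = {s\<in>S. a s > 0}"
    using sh[unfolded shatters_def, rule_format, of "{s\<in>S. a s > 0}"] by simp
  then obtain h where h: "h \<in> ltf d" "{x\<in>X. h x = 1} \<inter> S = {s\<in>S. a s > 0}" by blast
  have SX: "S \<subseteq> X"
    using sh[unfolded shatters_def, rule_format, of S] by blast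
  obtain r c where rc: "\<And>x. h x = pos ((\<Sum>i<d. r i * x i) + c)"
    using h(1) unfolding ltf_def by blast
  define u where "u s = (\<Sum>i<d. r i * s i) + c" for s
  have u: "u s > 0 \<longleftrightarrow> a s > 0" if "s \<in> S" for s
  proof -
    have "h s = 1 \<longleftrightarrow> a s > 0" using h(2) that SX by blast
    moreover have "h s = 1 \<longleftrightarrow> u s > 0" by (simp add: rc pos_def u_def)
    ultimately show ?thesis by simp
  qed
  have "(\<Sum>s\<in>S. a s * u s) = (\<Sum>s\<in>S. \<Sum>i<d. r i * (a s * s i)) + c * (\<Sum>s\<in>S. a s)"
    by (simp add: u_def ring_distribs sum.distrib sum_distrib_left mult_ac)
  also have "(\<Sum>s\<in>S. \<Sum>i<d. r i * (a s * s i)) = (\<Sum>i<d. r i * (\<Sum>s\<in>S. a s * s i))"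
    by (subst sum.swap) (simp add: sum_distrib_left)
  finally have "(\<Sum>s\<in>S. a s * u s) = 0" using a1 ai by simp
  moreover have "(\<Sum>s\<in>S. a s * u s) > 0"
  proof (rule sum_pos2[OF \<open>finite S\<close> s0(1)])
    show "0 < a s0 * u s0" using u s0 by simp
    show "0 \<le> a s * u s" if "s \<in> S" for s
      using u[OF that] by (cases "a s > 0") (auto simp: not_less mult_nonpos_nonpos)
  qed
  ultimately show False by simp
qed

text \<open>The family of traces has at most as many members as it shatters sets, and these have at
  most \<open>d + 1\<close> points.\<close>

lemma card_ltf_traces_le:
  fixes t :: real
  assumes X: "finite X" "card X \<le> N" and t: "0 < t" "t \<le> 1"
  shows "real (card ((\<lambda>h. {x\<in>X. h x = 1}) ` ltf d)) \<le> exp (t * real N) / t ^ Suc d"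
proof -
  let ?F = "(\<lambda>h. {x\<in>X. h x = 1}) ` ltf d"
  have "card ?F \<le> card {S. S \<subseteq> X \<and> shatters ?F S}"
    using X by (intro card_le_card_shattered) auto
  also have "\<dots> \<le> card {S. S \<subseteq> X \<and> card S \<le> Suc d}"
    using X card_shattered_by_ltf[of _ X d] finite_subset[OF _ X(1)]
    by (intro card_mono) auto
  finally show ?thesis using card_subsets_le_exp[OF X t, of "Suc d"] by linarith
qed

section \<open>Relative uniform deviation\<close>

lemma prod_if_one_eq_power_card:
  fixes c :: real
  assumes "finite J"
  shows "(\<Prod>j\<in>J. if P j then c else 1) = c ^ card {j\<in>J. P j}"
  using assms by (simp add: prod.If_cases Collect_conj_eq)

text \<open>Positions below \<open>m\<close> hold the sample, those from \<open>m\<close> on the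
  ghost sample; \<open>\<sigma>\<close> lists the pairs \<open>j\<close>, \<open>m + j\<close> that
  are exchanged.\<close>

definition pair_swap :: "nat \<Rightarrow> nat set \<Rightarrow> nat \<Rightarrow> nat" where
  "pair_swap m \<sigma> j = (if j \<in> \<sigma> then m + j else if m \<le> j \<and> j - m \<in> \<sigma> then j - m else j)"

lemma pair_swap_in:
  assumes "\<sigma> \<subseteq> {..<m}" "j < 2 * m"
  shows "pair_swap m \<sigma> j < 2 * m"
  using assms by (auto simp: pair_swap_def)

lemma pair_swap_invol:
  assumes "\<sigma> \<subseteq> {..<m}"
  shows "pair_swap m \<sigma> (pair_swap m \<sigma> j) = j"
proof -
  have "m + i \<notin> \<sigma>" for i using assms by auto
  then show ?thesis using assms by (auto simp: pair_swap_def)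
qed

text \<open>The weight \<open>(2/3)\<close> per hit in the first half and \<open>(4/3)\<close> per hit in the second half has
  average at most \<open>1\<close> over the two orders of a pair, hence over all swaps, while each unbalanced swap
  has weight at least \<open>(32/27) powr a\<close>.\<close>

lemma card_unbalanced_swaps_le:
  fixes a :: real and \<tau> :: "nat set"
  assumes "0 \<le> a"
  shows "real (card {\<sigma>\<in>Pow {..<m}. real (card {j\<in>{..<m}. pair_swap m \<sigma> j \<in> \<tau>}) \<le> a
      \<and> 2 * a \<le> real (card {j\<in>{m..<2*m}. pair_swap m \<sigma> j \<in> \<tau>})}) \<le> 2 ^ m * (27/32) powr a"
proof -
  define w1 :: "nat \<Rightarrow> real" where "w1 j = (if j \<in> \<tau> then 2/3 else 1)" for j
  define w2 :: "nat \<Rightarrow> real" where "w2 j = (if j \<in> \<tau> then 4/3 else 1)" for j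
  define W where "W \<sigma> = (\<Prod>j<m. w1 (pair_swap m \<sigma> j)) * (\<Prod>j\<in>{m..<2*m}. w2 (pair_swap m \<sigma> j))" for \<sigma>
  let ?U = "{\<sigma>\<in>Pow {..<m}. real (card {j\<in>{..<m}. pair_swap m \<sigma> j \<in> \<tau>}) \<le> a
      \<and> 2 * a \<le> real (card {j\<in>{m..<2*m}. pair_swap m \<sigma> j \<in> \<tau>})}"
  have W_nonneg: "0 \<le> W \<sigma>" for \<sigma>
    unfolding W_def w1_def w2_def by (intro mult_nonneg_nonneg prod_nonneg) auto
  \<comment> \<open>Grouped by pairs, the weight has one factor per pair, which depends only on
    whether that pair is swapped. The sum over all \<open>\<sigma>\<close> therefore
    factorises.\<close>
  have W_eq: "W \<sigma> = (\<Prod>j\<in>\<sigma>. w1 (m + j) * w2 j) * (\<Prod>j\<in>{..<m}-\<sigma>. w1 j * w2 (m + j))"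
    if \<sigma>: "\<sigma> \<subseteq> {..<m}" for \<sigma>
  proof -
    have "(\<Prod>j\<in>{m..<2*m}. w2 (pair_swap m \<sigma> j)) = (\<Prod>j<m. w2 (pair_swap m \<sigma> (m + j)))"
      using prod.shift_bounds_nat_ivl[of "\<lambda>j. w2 (pair_swap m \<sigma> j)" 0 m m]
      by (simp add: atLeast0LessThan mult_2 add.commute)
    then have "W \<sigma> = (\<Prod>j<m. w1 (pair_swap m \<sigma> j) * w2 (pair_swap m \<sigma> (m + j)))"
      by (simp add: W_def prod.distrib)
    also have "\<dots> = (\<Prod>j\<in>\<sigma>. w1 (pair_swap m \<sigma> j) * w2 (pair_swap m \<sigma> (m + j)))
        * (\<Prod>j\<in>{..<m}-\<sigma>. w1 (pair_swap m \<sigma> j) * w2 (pair_swap m \<sigma> (m + j)))"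
      using \<sigma> by (subst prod.subset_diff[of \<sigma>]) auto
    also have "\<dots> = (\<Prod>j\<in>\<sigma>. w1 (m + j) * w2 j) * (\<Prod>j\<in>{..<m}-\<sigma>. w1 j * w2 (m + j))"
    proof -
      have "m + j \<notin> \<sigma>" for j using \<sigma> by auto
      then show ?thesis using \<sigma>
        by (intro arg_cong2[where f="(*)"] prod.cong) (auto simp: pair_swap_def)
    qed
    finally show ?thesis .
  qed
  have W_ge: "(32/27) powr a \<le> W \<sigma>" if "\<sigma> \<in> ?U" for \<sigma>
  proof -
    let ?n1 = "card {j\<in>{..<m}. pair_swap m \<sigma> j \<in> \<tau>}"
    let ?n2 = "card {j\<in>{m..<2*m}. pair_swap m \<sigma> j \<in> \<tau>}"
    have W: "W \<sigma> = (2/3) ^ ?n1 * (4/3) ^ ?n2"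
      by (simp add: W_def w1_def w2_def prod_if_one_eq_power_card)
    have "(4/3::real) powr (2 * a) = ((4/3) powr 2) powr a" by (simp only: powr_powr)
    also have "(4/3::real) powr 2 = 16/9" by (simp add: power2_eq_square)
    \<comment> \<open>At most \<open>a\<close> hits of weight 2/3 and at least \<open>2 * a\<close>
      hits of weight 4/3 leave the base 2/3 * 16/9 = 32/27.\<close>
    finally have "(32/27::real) powr a = (2/3) powr a * (4/3) powr (2 * a)"
      using powr_mult[of "2/3::real" "16/9" a] by simp
    also have "\<dots> \<le> (2/3) powr ?n1 * (4/3) powr ?n2"
      using that by (intro mult_mono powr_mono powr_mono') auto
    finally show ?thesis by (simp add: W powr_realpow)
  qed
  have "real (card ?U) * (32/27) powr a = (\<Sum>\<sigma>\<in>?U. (32/27) powr a)" by simp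
  also have "\<dots> \<le> (\<Sum>\<sigma>\<in>?U. W \<sigma>)" by (intro sum_mono W_ge)
  also have "\<dots> \<le> (\<Sum>\<sigma>\<in>Pow {..<m}. W \<sigma>)"
    using W_nonneg by (intro sum_mono2) auto
  also have "\<dots> = (\<Prod>j<m. w1 (m + j) * w2 j + w1 j * w2 (m + j))"
    by (subst prod_add) (auto intro!: sum.cong W_eq)
  \<comment> \<open>A pair with no hit gives 2, with one hit 2/3 + 4/3 = 2, with two hits 2 *
    8/9.\<close>
  also have "\<dots> \<le> (\<Prod>j<m. 2)"
    by (intro prod_mono) (auto simp: w1_def w2_def)
  finally have *: "real (card ?U) * (32/27) powr a \<le> 2 ^ m" by simp
  have "real (card ?U) = real (card ?U) * (32/27) powr a * (27/32) powr a"
    by (simp add: mult.assoc powr_mult[symmetric])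
  also have "\<dots> \<le> 2 ^ m * (27/32) powr a" using * by (intro mult_right_mono) auto
  finally show ?thesis .
qed

lemma borel_measurable_card_hits:
  assumes A: "\<And>j. j \<in> J \<Longrightarrow> A \<in> sets (N j)" and J: "finite J" "J \<subseteq> I"
  shows "(\<lambda>y. real (card {j\<in>J. y j \<in> A})) \<in> borel_measurable (Pi\<^sub>M I N)"
proof -
  have "(\<lambda>y. \<Sum>j\<in>J. indicator A (y j) :: real) \<in> borel_measurable (Pi\<^sub>M I N)"
    using A J
    by (intro borel_measurable_sum measurable_compose[OF measurable_component_singleton
          borel_measurable_indicator]) auto
  moreover have "(\<Sum>j\<in>J. indicator A (y j) :: real) = real (card {j\<in>J. y j \<in> A})" for y
    using J by (simp add: indicator_def sum.If_cases Collect_conj_eq)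
  ultimately show ?thesis by simp
qed

context prob_space
begin

text \<open>A lower Chernoff bound. The number of hits \<open>X\<close> has mean at least
  \<open>4 * \<epsilon> * card J\<close>, and Markov's inequality for \<open>(1/2) ^ X\<close>
  bounds the chance of fewer than half as many.\<close>

lemma prob_many_hits_ge_half:
  fixes \<epsilon> :: real
  assumes A: "A \<in> sets M" and J: "finite J" and p: "4 * \<epsilon> \<le> prob A" and n: "10 \<le> \<epsilon> * real (card J)"
  shows "1/2 \<le> measure (Pi\<^sub>M J (\<lambda>_. M)) {y\<in>space (Pi\<^sub>M J (\<lambda>_. M)). 2 * (\<epsilon> * card J) \<le> real (card {j\<in>J. y j \<in> A})}"
proof -
  interpret P: product_sigma_finite "\<lambda>_. M" by unfold_locales
  interpret N: prob_space "Pi\<^sub>M J (\<lambda>_. M)" by (rule prob_space_PiM) unfold_locales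
  let ?N = "Pi\<^sub>M J (\<lambda>_. M)" and ?a = "\<epsilon> * real (card J)"
  define X where "X y = card {j\<in>J. y j \<in> A}" for y :: "'b \<Rightarrow> 'a"
  define f :: "'a \<Rightarrow> real" where "f x = (if x \<in> A then 1/2 else 1)" for x
  have X_meas[measurable]: "(\<lambda>y. real (X y)) \<in> borel_measurable ?N"
    unfolding X_def using A J by (intro borel_measurable_card_hits) auto
  have prod_f: "(\<Prod>j\<in>J. f (y j)) = (1/2) ^ X y" for y
    using prod_if_one_eq_power_card[OF J, of "\<lambda>j. y j \<in> A" "1/2"]
    by (simp add: X_def f_def)
  have "f = (\<lambda>x. 1 - indicator A x / 2)" by (auto simp: f_def)
  moreover have "integrable M (indicator A :: 'a \<Rightarrow> real)"
    using A by (intro integrable_real_indicator) (auto simp: emeasure_eq_measure)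
  ultimately have int_f: "integrable M f" "integral\<^sup>L M f = 1 - prob A / 2"
    using A by (auto simp: prob_space)
  have int: "integrable ?N (\<lambda>y. (1/2) ^ X y :: real)"
    using P.product_integrable_prod[OF J, of "\<lambda>_. f"] int_f by (simp add: prod_f)
  let ?F = "{y\<in>space ?N. real (X y) < 2 * ?a}"
  have F: "?F \<in> sets ?N" by measurable
  have "measure ?N ?F * (1/2) powr (2 * ?a) = (\<integral>y. indicator ?F y * (1/2) powr (2 * ?a) \<partial>?N)"
    using F by simp
  also have "\<dots> \<le> (\<integral>y. (1/2) ^ X y \<partial>?N)"
  proof (rule integral_mono)
    show "integrable ?N (\<lambda>y. indicator ?F y * (1/2) powr (2 * ?a) :: real)"
      using F by (intro integrable_mult_left integrable_real_indicator) (auto simp: N.emeasure_eq_measure)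
    show "indicator ?F y * (1/2) powr (2 * ?a) \<le> (1/2 :: real) ^ X y" for y
    proof (cases "y \<in> ?F")
      case True
      then have "(1/2 :: real) powr (2 * ?a) \<le> (1/2) powr real (X y)"
        by (intro powr_mono') auto
      then show ?thesis using True by (simp add: powr_realpow)
    qed auto
  qed (rule int)
  also have "\<dots> = (1 - prob A / 2) ^ card J"
    using P.product_integral_prod[OF J, of "\<lambda>_. f"] int_f by (simp add: prod_f)
  also have "\<dots> \<le> exp (- (2 * \<epsilon>)) ^ card J"
  proof (rule power_mono)
    have "1 - prob A / 2 \<le> 1 + - (2 * \<epsilon>)" using p by simp
    also have "\<dots> \<le> exp (- (2 * \<epsilon>))" by (rule exp_ge_add_one_self)
    finally show "1 - prob A / 2 \<le> exp (- (2 * \<epsilon>))" .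
    show "0 \<le> 1 - prob A / 2" using prob_le_1[of A] by linarith
  qed
  also have "\<dots> = exp (- 2 * ?a)" by (simp flip: exp_of_nat_mult add: mult_ac)
  finally have "measure ?N ?F * (1/2) powr (2 * ?a) \<le> exp (- 2 * ?a)" .
  moreover have half: "(1/2::real) powr (2 * ?a) = exp (- (2 * ?a * ln 2))"
    by (simp add: powr_def ln_div)
  ultimately have "measure ?N ?F * exp (- (2 * ?a * ln 2)) * exp (2 * ?a * ln 2)
      \<le> exp (- 2 * ?a) * exp (2 * ?a * ln 2)"
    by (intro mult_right_mono) auto
  then have "measure ?N ?F \<le> exp (- 2 * ?a) * exp (2 * ?a * ln 2)"
    by (simp add: mult.assoc flip: exp_add)
  also have "\<dots> = exp (- (2 * ?a * (1 - ln 2)))"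
    by (simp add: exp_add[symmetric] algebra_simps)
  also have "\<dots> \<le> exp (- 1)"
  proof -
    \<comment> \<open>The left side is 20 * 11/36, which exceeds 1.\<close>
    have "2 * 10 * (1 - 25/36) \<le> 2 * ?a * (1 - ln 2 :: real)"
      using n ln2_le_25_over_36 by (intro mult_mono) auto
    then show ?thesis by simp
  qed
  also have "\<dots> \<le> 1/2" using exp_ge_add_one_self[of 1] by (simp add: exp_minus field_simps)
  finally have "measure ?N ?F \<le> 1/2" .
  moreover have "{y\<in>space ?N. 2 * ?a \<le> real (X y)} = space ?N - ?F" by auto
  ultimately show ?thesis using N.prob_compl[OF F] by (simp add: X_def)
qed

text \<open>Symmetrisation: next to a bad sample, an independent ghost sample hits the witnessing
  set at least \<open>2 * \<epsilon> * m\<close> times with probability at least one half. The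
  double sample is invariant under swaps, so it suffices to count unbalanced swaps of a fixed double
  sample, with a union bound over its at most \<open>K\<close> traces. Countability of
  \<open>\<A>\<close> makes the bad event measurable.\<close>

lemma relative_uniform_deviation:
  fixes \<epsilon> K :: real and m :: nat and \<A> :: "'a set set"
  defines "S \<equiv> Pi\<^sub>M {..<m} (\<lambda>_. M)"
  defines "Bad \<equiv> {\<omega>\<in>space S. \<exists>A\<in>\<A>. 4 * \<epsilon> < prob A \<and> real (card {j\<in>{..<m}. \<omega> j \<in> A}) \<le> \<epsilon> * real m}"
  assumes \<A>: "countable \<A>" "\<A> \<subseteq> sets M" and \<epsilon>: "10 \<le> \<epsilon> * real m"
    and K: "\<And>\<omega>. real (card ((\<lambda>A. {j. j < 2 * m \<and> \<omega> j \<in> A}) ` \<A>)) \<le> K"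
  shows "Bad \<in> sets S" "measure S Bad \<le> 2 * K * (27/32) powr (\<epsilon> * real m)"
proof -
  let ?I = "{..<m}" and ?J = "{m..<2*m}" and ?a = "\<epsilon> * real m"
  define T where "T = Pi\<^sub>M (?I \<union> ?J) (\<lambda>_. M)"
  define \<A>' where "\<A>' = {A\<in>\<A>. 4 * \<epsilon> < prob A}"
  have IJ: "?I \<union> ?J = {..<2*m}" by auto
  have \<A>': "countable \<A>'" "\<A>' \<subseteq> sets M" "\<A>' \<subseteq> \<A>" using \<A> by (auto simp: \<A>'_def)
  interpret S: prob_space S unfolding S_def by (rule prob_space_PiM) unfold_locales
  interpret T: prob_space T unfolding T_def by (rule prob_space_PiM) unfold_locales
  interpret P: product_sigma_finite "\<lambda>_. M" by unfold_locales
  interpret J: prob_space "Pi\<^sub>M ?J (\<lambda>_. M)" by (rule prob_space_PiM) unfold_locales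
  have cS: "(\<lambda>y. real (card {j\<in>?I. y j \<in> A})) \<in> borel_measurable S" if "A \<in> \<A>'" for A
    unfolding S_def using that \<A>' by (intro borel_measurable_card_hits) auto
  have cT: "(\<lambda>y. real (card {j\<in>?I. y j \<in> A})) \<in> borel_measurable T"
      "(\<lambda>y. real (card {j\<in>?J. y j \<in> A})) \<in> borel_measurable T" if "A \<in> \<A>'" for A
    unfolding T_def using that \<A>' by (intro borel_measurable_card_hits; auto)+
  have "Bad = (\<Union>A\<in>\<A>'. {\<omega>\<in>space S. real (card {j\<in>?I. \<omega> j \<in> A}) \<le> ?a})"
    unfolding Bad_def \<A>'_def by blast
  also have "\<dots> \<in> sets S"
  proof (rule sets.countable_UN''[OF \<A>'(1)])
    show "{\<omega>\<in>space S. real (card {j\<in>?I. \<omega> j \<in> A}) \<le> ?a} \<in> sets S" if "A \<in> \<A>'" for A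
      using cS[OF that] by measurable
  qed
  finally show Bad: "Bad \<in> sets S" .
  define G where "G = (\<Union>A\<in>\<A>'. {\<omega>\<in>space T. real (card {j\<in>?I. \<omega> j \<in> A}) \<le> ?a
      \<and> 2 * ?a \<le> real (card {j\<in>?J. \<omega> j \<in> A})})"
  have G: "G \<in> sets T"
    unfolding G_def
  proof (rule sets.countable_UN''[OF \<A>'(1)])
    show "{\<omega>\<in>space T. real (card {j\<in>?I. \<omega> j \<in> A}) \<le> ?a
        \<and> 2 * ?a \<le> real (card {j\<in>?J. \<omega> j \<in> A})} \<in> sets T" if "A \<in> \<A>'" for A
      using cT[OF that] by measurable
  qed

  \<comment> \<open>Fubini over the two halves: the witness \<open>A\<close> is fixed by the first
    half before the ghost sample is drawn, so the section of \<open>G\<close> over a bad sample has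
    mass at least one half.\<close>
  have "ennreal (measure S Bad / 2) = (\<integral>\<^sup>+x. ennreal (1/2) * indicator Bad x \<partial>S)"
    by (subst nn_integral_cmult_indicator[OF Bad])
       (simp add: S.emeasure_eq_measure ennreal_mult[symmetric] del: ennreal_half)
  also have "\<dots> \<le> (\<integral>\<^sup>+x. emeasure (Pi\<^sub>M ?J (\<lambda>_. M))
      ((\<lambda>y. merge ?I ?J (x, y)) -` G \<inter> space (Pi\<^sub>M ?J (\<lambda>_. M))) \<partial>S)"
  proof (rule nn_integral_mono)
    fix x assume x: "x \<in> space S"
    let ?N = "Pi\<^sub>M ?J (\<lambda>_. M)"
    show "ennreal (1/2) * indicator Bad x \<le> emeasure ?N ((\<lambda>y. merge ?I ?J (x, y)) -` G \<inter> space ?N)"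
    proof (cases "x \<in> Bad")
      case True
      then obtain A where A: "A \<in> \<A>'" "real (card {j\<in>?I. x j \<in> A}) \<le> ?a"
        by (auto simp: Bad_def \<A>'_def)
      have A': "A \<in> sets M" "4 * \<epsilon> \<le> prob A" using A(1) \<A>' by (auto simp: \<A>'_def)
      let ?H = "{y\<in>space ?N. 2 * ?a \<le> real (card {j\<in>?J. y j \<in> A})}"
      have "1/2 \<le> measure ?N ?H"
        using prob_many_hits_ge_half[OF A'(1) _ A'(2), of ?J] \<epsilon> by simp
      then have "ennreal (1/2) \<le> emeasure ?N ?H" 
        unfolding J.emeasure_eq_measure by (rule ennreal_leI)
      also have "\<dots> \<le> emeasure ?N ((\<lambda>y. merge ?I ?J (x, y)) -` G \<inter> space ?N)"
      proof (rule emeasure_mono)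
        show "?H \<subseteq> (\<lambda>y. merge ?I ?J (x, y)) -` G \<inter> space ?N"
        proof
          fix y assume y: "y \<in> ?H"
          have "merge ?I ?J (x, y) \<in> space T"
            using x y by (auto simp: T_def S_def space_PiM PiE_iff merge_def extensional_def)
          moreover have "{j\<in>?I. merge ?I ?J (x, y) j \<in> A} = {j\<in>?I. x j \<in> A}"
            "{j\<in>?J. merge ?I ?J (x, y) j \<in> A} = {j\<in>?J. y j \<in> A}"
            by (auto simp: merge_def)
          ultimately have "merge ?I ?J (x, y) \<in> G"
            using A y unfolding G_def by (intro UN_I[OF A(1)]) simp
          then show "y \<in> (\<lambda>y. merge ?I ?J (x, y)) -` G \<inter> space ?N" using y by simp
        qed
        have "(\<lambda>y. merge ?I ?J (x, y)) \<in> measurable ?N T"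
          unfolding T_def using x[unfolded S_def]
          by (intro measurable_compose[OF measurable_Pair1' measurable_merge])
        then show "(\<lambda>y. merge ?I ?J (x, y)) -` G \<inter> space ?N \<in> sets ?N"
          using G by (rule measurable_sets)
      qed
      finally show ?thesis using True by simp
    qed simp
  qed
  also have "\<dots> = emeasure T G"
    unfolding T_def S_def using G[unfolded T_def] by (intro P.emeasure_fold_integral[symmetric]) auto
  finally have step1: "measure S Bad / 2 \<le> measure T G"
    by (simp add: T.emeasure_eq_measure)

  define \<pi> where "\<pi> \<sigma> \<omega> = (\<lambda>n\<in>?I \<union> ?J. \<omega> (pair_swap m \<sigma> n))" for \<sigma> and \<omega> :: "nat \<Rightarrow> 'a"
  have \<pi>: "\<pi> \<sigma> \<in> measurable T T" "emeasure T (\<pi> \<sigma> -` G \<inter> space T) = emeasure T G"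
    if \<sigma>: "\<sigma> \<in> Pow ?I" for \<sigma>
  proof -
    have inj: "inj_on (pair_swap m \<sigma>) (?I \<union> ?J)"
      using pair_swap_invol[of \<sigma> m] \<sigma> by (intro inj_on_inverseI[where g="pair_swap m \<sigma>"]) auto
    have in_IJ: "pair_swap m \<sigma> \<in> ?I \<union> ?J \<rightarrow> ?I \<union> ?J"
      unfolding IJ using pair_swap_in[of \<sigma> m] \<sigma> by auto
    show meas: "\<pi> \<sigma> \<in> measurable T T"
      unfolding \<pi>_def T_def using in_IJ
      by (intro measurable_restrict measurable_component_singleton) auto
    \<comment> \<open>All coordinates have the same law, so permuting them preserves the product
      measure.\<close>
    have "distr T T (\<pi> \<sigma>) = T"
      unfolding T_def \<pi>_def using inj in_IJ
      by (intro distr_PiM_reindex[where M="\<lambda>_. M"]) unfold_locales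
    then show "emeasure T (\<pi> \<sigma> -` G \<inter> space T) = emeasure T G"
      using emeasure_distr[OF meas G] by simp
  qed
  \<comment> \<open>With the double sample fixed, a set matters only through its trace, so the union
    bound is finite even if \<open>\<A>\<close> is infinite.\<close>
  have count: "real (card {\<sigma>\<in>Pow ?I. \<pi> \<sigma> \<omega> \<in> G}) \<le> K * (2 ^ m * (27/32) powr ?a)" for \<omega>
  proof -
    let ?tr = "(\<lambda>A. {j. j < 2 * m \<and> \<omega> j \<in> A}) ` \<A>"
    let ?U = "\<lambda>\<tau>. {\<sigma>\<in>Pow ?I. real (card {j\<in>?I. pair_swap m \<sigma> j \<in> \<tau>}) \<le> ?a
      \<and> 2 * ?a \<le> real (card {j\<in>?J. pair_swap m \<sigma> j \<in> \<tau>})}"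
    have fin: "finite ?tr" by (rule finite_subset[of _ "Pow {..<2*m}"]) auto
    have "{\<sigma>\<in>Pow ?I. \<pi> \<sigma> \<omega> \<in> G} \<subseteq> (\<Union>\<tau>\<in>?tr. ?U \<tau>)"
    proof safe
      fix \<sigma> assume \<sigma>: "\<sigma> \<subseteq> ?I" and "\<pi> \<sigma> \<omega> \<in> G"
      then obtain A where A: "A \<in> \<A>" "real (card {j\<in>?I. \<pi> \<sigma> \<omega> j \<in> A}) \<le> ?a"
          "2 * ?a \<le> real (card {j\<in>?J. \<pi> \<sigma> \<omega> j \<in> A})"
        using \<A>' by (auto simp: G_def)
      let ?\<tau> = "{j. j < 2 * m \<and> \<omega> j \<in> A}"
      have hit: "\<pi> \<sigma> \<omega> j \<in> A \<longleftrightarrow> pair_swap m \<sigma> j \<in> ?\<tau>" if "j \<in> ?I \<union> ?J" for j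
        using that pair_swap_in[OF \<sigma>, of j] by (simp add: \<pi>_def IJ)
      have "{j\<in>?I. \<pi> \<sigma> \<omega> j \<in> A} = {j\<in>?I. pair_swap m \<sigma> j \<in> ?\<tau>}"
        "{j\<in>?J. \<pi> \<sigma> \<omega> j \<in> A} = {j\<in>?J. pair_swap m \<sigma> j \<in> ?\<tau>}"
        using hit by blast+
      then have "\<sigma> \<in> ?U ?\<tau>" using A \<sigma> by simp
      then show "\<sigma> \<in> (\<Union>\<tau>\<in>?tr. ?U \<tau>)" using A(1) by blast
    qed
    moreover have "finite (\<Union>\<tau>\<in>?tr. ?U \<tau>)" by (rule finite_subset[of _ "Pow ?I"]) auto
    ultimately have "card {\<sigma>\<in>Pow ?I. \<pi> \<sigma> \<omega> \<in> G} \<le> card (\<Union>\<tau>\<in>?tr. ?U \<tau>)"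
      by (rule card_mono[rotated])
    also have "\<dots> \<le> (\<Sum>\<tau>\<in>?tr. card (?U \<tau>))" by (rule card_UN_le[OF fin])
    finally have "real (card {\<sigma>\<in>Pow ?I. \<pi> \<sigma> \<omega> \<in> G}) \<le> (\<Sum>\<tau>\<in>?tr. real (card (?U \<tau>)))"
      by (simp only: of_nat_sum[symmetric] of_nat_le_iff)
    also have "\<dots> \<le> (\<Sum>\<tau>\<in>?tr. 2 ^ m * (27/32) powr ?a)"
      using \<epsilon> by (intro sum_mono card_unbalanced_swaps_le) simp
    also have "\<dots> = real (card ?tr) * (2 ^ m * (27/32) powr ?a)" by simp
    also have "\<dots> \<le> K * (2 ^ m * (27/32) powr ?a)" using K by (intro mult_right_mono) auto
    finally show ?thesis .
  qed
  have K_nonneg: "0 \<le> K" using K[of undefined] by (rule order_trans[rotated]) simp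
  \<comment> \<open>Averaging over swaps: each of the \<open>2 ^ m\<close> swaps yields the same
    probability, and exchanging sum and integral reduces the claim to the pointwise count.\<close>
  have "ennreal (2 ^ m * measure T G) = (\<Sum>\<sigma>\<in>Pow ?I. emeasure T G)"
    by (simp add: T.emeasure_eq_measure card_Pow ennreal_mult flip: ennreal_power)
  also have "\<dots> = (\<Sum>\<sigma>\<in>Pow ?I. \<integral>\<^sup>+\<omega>. indicator (\<pi> \<sigma> -` G \<inter> space T) \<omega> \<partial>T)"
    using \<pi> measurable_sets[OF \<pi>(1) G] by (intro sum.cong) auto
  also have "\<dots> = (\<integral>\<^sup>+\<omega>. (\<Sum>\<sigma>\<in>Pow ?I. indicator (\<pi> \<sigma> -` G \<inter> space T) \<omega>) \<partial>T)"
    using measurable_sets[OF \<pi>(1) G] by (intro nn_integral_sum[symmetric]) auto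
  also have "\<dots> \<le> (\<integral>\<^sup>+\<omega>. ennreal (K * (2 ^ m * (27/32) powr ?a)) \<partial>T)"
  proof (rule nn_integral_mono)
    fix \<omega> assume "\<omega> \<in> space T"
    then have "(\<Sum>\<sigma>\<in>Pow ?I. indicator (\<pi> \<sigma> -` G \<inter> space T) \<omega> :: ennreal)
        = of_nat (card {\<sigma>\<in>Pow ?I. \<pi> \<sigma> \<omega> \<in> G})"
      by (simp add: indicator_def sum.If_cases Collect_conj_eq Pow_def)
    also have "\<dots> = ennreal (real (card {\<sigma>\<in>Pow ?I. \<pi> \<sigma> \<omega> \<in> G}))"
      by (simp add: ennreal_of_nat_eq_real_of_nat)
    also have "\<dots> \<le> ennreal (K * (2 ^ m * (27/32) powr ?a))"
      by (intro ennreal_leI count)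
    finally show "(\<Sum>\<sigma>\<in>Pow ?I. indicator (\<pi> \<sigma> -` G \<inter> space T) \<omega>)
        \<le> ennreal (K * (2 ^ m * (27/32) powr ?a))" .
  qed
  also have "\<dots> = ennreal (K * (2 ^ m * (27/32) powr ?a))" by (simp add: T.emeasure_space_1)
  finally have "2 ^ m * measure T G \<le> 2 ^ m * (K * (27/32) powr ?a)"
    using K_nonneg by (subst (asm) ennreal_le_iff) (auto simp: mult_ac)
  then have "measure T G \<le> K * (27/32) powr ?a" by (rule mult_left_le_imp_le) simp
  with step1 show "measure S Bad \<le> 2 * K * (27/32) powr ?a" by simp
qed

end

section \<open>Agreement of two binomial variables\<close>

definition binom_prob :: "nat \<Rightarrow> real \<Rightarrow> nat \<Rightarrow> real" where
  "binom_prob n p a = real (n choose a) * p ^ a * (1 - p) ^ (n - a)"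

lemma binom_prob_nonneg: "0 \<le> p \<Longrightarrow> p \<le> 1 \<Longrightarrow> 0 \<le> binom_prob n p a"
  by (simp add: binom_prob_def)

lemma binom_prob_eq_0: "n < a \<Longrightarrow> binom_prob n p a = 0"
  by (simp add: binom_prob_def)

lemma sum_binom_prob: "(\<Sum>a\<le>n. binom_prob n p a) = 1"
  using binomial_ring[of p "1 - p" n] by (simp add: binom_prob_def mult.assoc)

lemma sum_binom_prob_le_1:
  assumes "0 \<le> p" "p \<le> 1" "finite A"
  shows "(\<Sum>a\<in>A. binom_prob n p a) \<le> 1"
proof -
  have "(\<Sum>a\<in>A. binom_prob n p a) \<le> (\<Sum>a\<in>A \<union> {..n}. binom_prob n p a)"
    using assms by (intro sum_mono2) (auto intro: binom_prob_nonneg)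
  also have "\<dots> = (\<Sum>a\<le>n. binom_prob n p a)"
    using assms by (intro sum.mono_neutral_right) (auto simp: not_le intro: binom_prob_eq_0)
  finally show ?thesis by (simp add: sum_binom_prob)
qed

text \<open>The probabilities of the two neighbours of an interior value multiply to at least a quarter
  of its square, so by AM-GM the neighbours together weigh at least as much as the value itself.\<close>

lemma binom_prob_interior_le_half:
  assumes p: "0 \<le> p" "p \<le> 1" and a: "0 < a" "a < n"
  shows "binom_prob n p a \<le> 1/2"
proof -
  obtain b where b: "a = Suc b" using a by (cases a) auto
  obtain c where c: "n = Suc (Suc (b + c))" using a b by (metis Suc_lessE add_Suc less_iff_Suc_add)
  let ?C = "\<lambda>i. real (n choose i)"
  have "Suc b * (n choose Suc b) = Suc (Suc c) * (n choose b)"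
    using Suc_times_binomial_add[of b "Suc c"] by (simp add: c)
  then have e1: "(real b + 1) * ?C a = (real c + 2) * ?C b"
    unfolding b by (metis (no_types, opaque_lifting) of_nat_Suc of_nat_mult add.commute add_Suc_right add_2_eq_Suc' of_nat_add of_nat_numeral)
  have "Suc (Suc b) * (n choose Suc (Suc b)) = Suc c * (n choose Suc b)"
    using Suc_times_binomial_add[of "Suc b" c] by (simp add: c)
  then have e2: "(real b + 2) * ?C (Suc a) = (real c + 1) * ?C a"
    unfolding b by (metis (no_types, opaque_lifting) of_nat_Suc of_nat_mult add.commute add_Suc_right add_2_eq_Suc' of_nat_add of_nat_numeral)
  \<comment> \<open>The quotients \<open>(b + 2) / (b + 1)\<close> and
    \<open>(c + 2) / (c + 1)\<close> are each at most 2, which is the source of the factor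
    4.\<close>
  have "(?C a)\<^sup>2 * ((real b + 1) * (real c + 1)) = ?C b * ?C (Suc a) * ((real c + 2) * (real b + 2))"
    using arg_cong2[where f="(*)", OF e1 e2[symmetric]] by (simp add: power2_eq_square mult_ac)
  also have "\<dots> \<le> ?C b * ?C (Suc a) * (4 * ((real b + 1) * (real c + 1)))"
  proof (rule mult_left_mono)
    have "(real c + 2) * (real b + 2) \<le> (2 * (real c + 1)) * (2 * (real b + 1))"
      by (intro mult_mono) auto
    then show "(real c + 2) * (real b + 2) \<le> 4 * ((real b + 1) * (real c + 1))" by (simp add: algebra_simps)
  qed simp
  finally have "(?C a)\<^sup>2 * ((real b + 1) * (real c + 1)) \<le> (4 * (?C b * ?C (Suc a))) * ((real b + 1) * (real c + 1))"
    by (simp only: mult_ac)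
  moreover have "0 < (real b + 1) * (real c + 1)" by simp
  ultimately have C: "(?C a)\<^sup>2 \<le> 4 * (?C b * ?C (Suc a))"
    by (rule mult_right_le_imp_le)
  let ?x = "binom_prob n p b" and ?y = "binom_prob n p (Suc a)" and ?z = "binom_prob n p a"
  have nn: "0 \<le> ?x" "0 \<le> ?y" "0 \<le> ?z" using p by (auto intro: binom_prob_nonneg)
  have z2: "?z\<^sup>2 = (?C a)\<^sup>2 * (p ^ Suc b * (1 - p) ^ Suc c)\<^sup>2"
    by (simp add: binom_prob_def b c power_mult_distrib)
  have xy: "?x * ?y = ?C b * ?C (Suc a) * (p ^ Suc b * (1 - p) ^ Suc c)\<^sup>2"
    by (simp add: binom_prob_def b c power2_eq_square Suc_diff_le mult_ac)
  have "?z\<^sup>2 \<le> 4 * (?x * ?y)"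
    using mult_right_mono[OF C, of "(p ^ Suc b * (1 - p) ^ Suc c)\<^sup>2"] unfolding z2 xy
    by (simp add: mult_ac)
  also have "\<dots> \<le> (?x + ?y)\<^sup>2"
    using zero_le_power2[of "?x - ?y"] by (simp add: power2_eq_square algebra_simps)
  finally have "?z \<le> ?x + ?y" by (rule power2_le_imp_le) (use nn in simp)
  \<comment> \<open>Three distinct outcomes weigh at most 1 together, and the neighbours already
    weigh at least \<open>?z\<close>.\<close>
  moreover have "?x + (?z + ?y) \<le> 1"
    using sum_binom_prob_le_1[OF p, of "{b, a, Suc a}" n] by (simp add: b)
  ultimately show ?thesis by simp
qed

text \<open>Mass above one half rules out interior values. At the ends the mass is a power of
  \<open>1 - p\<close> or of \<open>p\<close>, at most its first power since \<open>n\<close> is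
  positive.\<close>

lemma binom_prob_concentrated:
  assumes p: "0 \<le> p" "p \<le> 1" and n: "1 \<le> n" and \<eta>: "\<eta> < 1/2" and "1 - \<eta> \<le> binom_prob n p a"
  shows "a = 0 \<and> p \<le> \<eta> \<or> a = n \<and> 1 - p \<le> \<eta>"
proof -
  consider "a = 0" | "a = n" | "0 < a" "a < n" | "n < a" by linarith
  then show ?thesis
  proof cases
    case 1
    then have "1 - \<eta> \<le> (1 - p) ^ n" using assms by (simp add: binom_prob_def)
    also have "\<dots> \<le> (1 - p) ^ 1" using p n by (intro power_decreasing) auto
    finally show ?thesis using 1 by simp
  next
    case 2
    then have "1 - \<eta> \<le> p ^ n" using assms by (simp add: binom_prob_def)
    also have "\<dots> \<le> p ^ 1" using p n by (intro power_decreasing) auto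
    finally show ?thesis using 2 by simp
  next
    case 3
    then show ?thesis using binom_prob_interior_le_half[OF p 3] assms by simp
  next
    case 4
    then show ?thesis using assms binom_prob_eq_0[OF 4, of p] by simp
  qed
qed

text \<open>The agreement probability averages the weights \<open>binom_prob l r a\<close>, so one
  of them, at \<open>b\<close>, is at least \<open>1 - \<eta>\<close>. The first law must then
  concentrate at the same \<open>b\<close>, which is an end of both ranges.\<close>

lemma binom_prob_agreement:
  assumes p: "0 \<le> p" "p \<le> 1" and r: "0 \<le> r" "r \<le> 1" and kl: "1 \<le> k" "1 \<le> l" and \<eta>: "\<eta> < 1/2"
    and ge: "1 - \<eta> \<le> (\<Sum>a\<le>k. binom_prob k p a * binom_prob l r a)"
  shows "p \<le> \<eta> \<and> r \<le> \<eta> \<or> k = l \<and> 1 - p \<le> \<eta> \<and> 1 - r \<le> \<eta>"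
proof -
  let ?x = "binom_prob k p" and ?y = "binom_prob l r"
  have nn: "0 \<le> ?x a" "0 \<le> ?y a" for a using p r by (auto intro: binom_prob_nonneg)
  have "\<exists>b\<le>k. 1 - \<eta> \<le> ?y b"
  proof (rule ccontr)
    assume "\<not> ?thesis"
    then have lt: "?y a < 1 - \<eta>" if "a \<le> k" for a using that by force
    \<comment> \<open>If all \<open>?y a\<close> were below \<open>1 - \<eta>\<close>, these
      nonnegative terms with sum at most 0 would force every \<open>?x a\<close> to vanish.\<close>
    have "(\<Sum>a\<le>k. ?x a * (1 - \<eta> - ?y a)) = (1 - \<eta>) * (\<Sum>a\<le>k. ?x a) - (\<Sum>a\<le>k. ?x a * ?y a)"
      by (simp add: right_diff_distrib sum_subtractf sum_distrib_left mult_ac)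
    then have le0: "(\<Sum>a\<le>k. ?x a * (1 - \<eta> - ?y a)) \<le> 0" using ge by (simp add: sum_binom_prob)
    have terms: "0 \<le> ?x a * (1 - \<eta> - ?y a)" if "a \<le> k" for a
      using nn(1)[of a] lt[OF that] by simp
    have "(\<Sum>a\<le>k. ?x a * (1 - \<eta> - ?y a)) = 0"
      using le0 terms by (intro antisym sum_nonneg) auto
    then have "\<forall>a\<in>{..k}. ?x a * (1 - \<eta> - ?y a) = 0"
      using terms by (subst (asm) sum_nonneg_eq_0_iff) auto
    then have "?x a = 0" if "a \<le> k" for a using lt[OF that] that by force
    then show False using sum_binom_prob[of k p] by simp
  qed
  then obtain b where b: "b \<le> k" "1 - \<eta> \<le> ?y b" by blast
  have le: "?y a \<le> 1 - ?y b" if "a \<noteq> b" for a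
    using sum_binom_prob_le_1[OF r, of "{a, b}" l] that by simp
  have "1 - \<eta> \<le> ?x b * ?y b + (\<Sum>a\<in>{..k}-{b}. ?x a * ?y a)"
    using ge b by (subst (asm) sum.remove[of _ b]) auto
  also have "\<dots> \<le> ?x b * ?y b + (\<Sum>a\<in>{..k}-{b}. ?x a * (1 - ?y b))"
    using le nn by (intro add_left_mono sum_mono mult_left_mono) auto
  also have "(\<Sum>a\<in>{..k}-{b}. ?x a * (1 - ?y b)) = (1 - ?x b) * (1 - ?y b)"
    using b sum_binom_prob[of k p] sum.remove[of "{..k}" b ?x] by (simp flip: sum_distrib_right)
  finally have *: "1 - \<eta> \<le> ?x b * ?y b + (1 - ?x b) * (1 - ?y b)" .
  have yb: "?y b \<le> 1" using sum_binom_prob_le_1[OF r, of "{b}" l] by simp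
  have xb_half: "1/2 < ?x b"
  proof (rule ccontr)
    assume "\<not> 1/2 < ?x b"
    \<comment> \<open>With \<open>x\<close> and \<open>y\<close> for the two masses at
      \<open>b\<close>, \<open>x * y + (1 - x) * (1 - y)\<close> equals
      \<open>1/2 + 2 * (x - 1/2) * (y - 1/2)\<close>.\<close>
    then have "(?y b - 1/2) * (?x b - 1/2) \<le> 0" using b \<eta> by (intro mult_nonneg_nonpos) auto
    then show False using * \<eta> by (simp add: algebra_simps)
  qed
  \<comment> \<open>This product is exactly the amount by which \<open>?x b\<close> exceeds the
    upper bound in \<open>*\<close>.\<close>
  have "0 \<le> (1 - ?y b) * (2 * ?x b - 1)" using xb_half yb by simp
  then have xb: "1 - \<eta> \<le> ?x b" using * by (simp add: algebra_simps)
  show ?thesis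
    using binom_prob_concentrated[OF p kl(1) \<eta> xb] binom_prob_concentrated[OF r kl(2) \<eta> b(2)] kl
    by auto
qed

text \<open>The event is covered by boxes that prescribe exactly which positions hit. A box has
  product measure depending only on the number of hits, and the binomial coefficients count the
  boxes.\<close>

lemma prob_equal_hits_le:
  fixes P Q :: "'a measure"
  assumes "prob_space P" "prob_space Q" and k: "k \<le> q" and X: "X \<in> sets P" and Y: "Y \<in> sets Q"
  defines "N \<equiv> \<Pi>\<^sub>M i\<in>{..<q}. if i < k then P else Q"
  shows "measure N {\<omega>\<in>space N. card {i\<in>{..<k}. \<omega> i \<in> X} = card {i\<in>{k..<q}. \<omega> i \<in> Y}}
    \<le> (\<Sum>a\<le>k. binom_prob k (measure P X) a * binom_prob (q - k) (measure Q Y) a)"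
proof -
  interpret P: prob_space P by fact
  interpret Q: prob_space Q by fact
  let ?M = "\<lambda>i. if i < k then P else Q"
  let ?p = "measure P X" and ?r = "measure Q Y"
  interpret M: prob_space "?M i" for i by (simp add: P.prob_space_axioms Q.prob_space_axioms)
  interpret PM: finite_product_prob_space ?M "{..<q}" by unfold_locales simp
  interpret N: prob_space N unfolding N_def by (rule prob_space_PiM) unfold_locales
  define box where "box = (\<lambda>(U, V). \<Pi>\<^sub>E i\<in>{..<q}. if i < k then (if i \<in> U then X else space P - X)
      else (if i \<in> V then Y else space Q - Y))"
  define W where "W a = {U. U \<subseteq> {..<k} \<and> card U = a} \<times> {V. V \<subseteq> {k..<q} \<and> card V = a}" for a
  have finW: "finite (W a)" for a
    unfolding W_def by (intro finite_cartesian_product) auto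
  have box: "box w \<in> sets N" for w
    unfolding box_def N_def using X Y by (auto split: prod.split intro!: sets_PiM_I_finite)
  have "{\<omega>\<in>space N. card {i\<in>{..<k}. \<omega> i \<in> X} = card {i\<in>{k..<q}. \<omega> i \<in> Y}}
      \<subseteq> (\<Union>w\<in>(\<Union>a\<le>k. W a). box w)"
  proof
    fix \<omega> assume "\<omega> \<in> {\<omega>\<in>space N. card {i\<in>{..<k}. \<omega> i \<in> X} = card {i\<in>{k..<q}. \<omega> i \<in> Y}}"
    then have \<omega>: "\<omega> \<in> space N" "card {i\<in>{..<k}. \<omega> i \<in> X} = card {i\<in>{k..<q}. \<omega> i \<in> Y}" by auto
    let ?U = "{i\<in>{..<k}. \<omega> i \<in> X}" and ?V = "{i\<in>{k..<q}. \<omega> i \<in> Y}"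
    have "card ?U \<le> card {..<k}" by (intro card_mono) auto
    then have "(?U, ?V) \<in> (\<Union>a\<le>k. W a)" using \<omega> by (auto simp: W_def)
    moreover have "\<omega> \<in> box (?U, ?V)"
      using \<omega>(1) by (auto simp: N_def box_def space_PiM PiE_iff split: if_splits)
    ultimately show "\<omega> \<in> (\<Union>w\<in>(\<Union>a\<le>k. W a). box w)" by blast
  qed
  then have "measure N {\<omega>\<in>space N. card {i\<in>{..<k}. \<omega> i \<in> X} = card {i\<in>{k..<q}. \<omega> i \<in> Y}}
      \<le> measure N (\<Union>w\<in>(\<Union>a\<le>k. W a). box w)"
    using box finW by (intro N.finite_measure_mono sets.finite_UN) auto
  also have "\<dots> \<le> (\<Sum>w\<in>(\<Union>a\<le>k. W a). measure N (box w))"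
    using box finW by (intro N.finite_measure_subadditive_finite) auto
  also have "\<dots> = (\<Sum>a\<le>k. \<Sum>w\<in>W a. measure N (box w))"
    using finW by (intro sum.UNION_disjoint) (auto simp: W_def)
  also have "\<dots> = (\<Sum>a\<le>k. binom_prob k ?p a * binom_prob (q - k) ?r a)"
  proof (rule sum.cong[OF refl])
    fix a
    have "measure N (box w) = ?p ^ a * (1 - ?p) ^ (k - a) * (?r ^ a * (1 - ?r) ^ (q - k - a))"
      if w_in: "w \<in> W a" for w
    proof -
      obtain U V where w: "w = (U, V)" and U: "U \<subseteq> {..<k}" "card U = a" and V: "V \<subseteq> {k..<q}" "card V = a"
        using w_in by (auto simp: W_def)
      let ?f = "\<lambda>i. if i < k then (if i \<in> U then ?p else 1 - ?p) else (if i \<in> V then ?r else 1 - ?r)"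
      have "measure N (box w) = (\<Prod>i<q. ?f i)"
        unfolding box_def w N_def prod.case using X Y
        by (subst PM.prob_times) (auto intro!: prod.cong simp: P.prob_compl Q.prob_compl)
      also have "{..<q} = {..<k} \<union> {k..<q}" using k by auto
      also have "(\<Prod>i\<in>{..<k} \<union> {k..<q}. ?f i) = (\<Prod>i<k. ?f i) * (\<Prod>i\<in>{k..<q}. ?f i)"
        by (intro prod.union_disjoint) auto
      also have "(\<Prod>i<k. ?f i) = (\<Prod>i<k. if i \<in> U then ?p else 1 - ?p)" by (intro prod.cong) auto
      also have "\<dots> = ?p ^ a * (1 - ?p) ^ (k - a)"
      proof -
        have "{..<k} \<inter> {i. i \<in> U} = U" "{..<k} \<inter> - {i. i \<in> U} = {..<k} - U" using U by auto
        then show ?thesis using U finite_subset[OF U(1)]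
          by (simp add: prod.If_cases card_Diff_subset)
      qed
      also have "(\<Prod>i\<in>{k..<q}. ?f i) = (\<Prod>i\<in>{k..<q}. if i \<in> V then ?r else 1 - ?r)" by (intro prod.cong) auto
      also have "\<dots> = ?r ^ a * (1 - ?r) ^ (q - k - a)"
      proof -
        have "{k..<q} \<inter> {i. i \<in> V} = V" "{k..<q} \<inter> - {i. i \<in> V} = {k..<q} - V" using V by auto
        then show ?thesis using V finite_subset[OF V(1)]
          by (simp add: prod.If_cases card_Diff_subset)
      qed
      finally show ?thesis .
    qed
    then have "(\<Sum>w\<in>W a. measure N (box w))
        = real (card (W a)) * (?p ^ a * (1 - ?p) ^ (k - a) * (?r ^ a * (1 - ?r) ^ (q - k - a)))" by simp
    moreover have "card (W a) = (k choose a) * ((q - k) choose a)"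
      by (simp add: W_def card_cartesian_product n_subsets)
    ultimately show "(\<Sum>w\<in>W a. measure N (box w)) = binom_prob k ?p a * binom_prob (q - k) ?r a"
      by (simp add: binom_prob_def)
  qed
  finally show ?thesis .
qed

section \<open>Bag errors of threshold functions\<close>

text \<open>Coefficients are given by a list because lists of rationals form a countable type,
  unlike functions from \<open>nat\<close> to \<open>rat\<close>.\<close>

definition rational_ltf :: "nat \<Rightarrow> ((nat \<Rightarrow> real) \<Rightarrow> real) set" where
  "rational_ltf d = range (\<lambda>(rs :: rat list, c :: rat). \<lambda>x. pos ((\<Sum>i<d. of_rat (rs ! i) * x i) + of_rat c))"

lemma countable_rational_ltf: "countable (rational_ltf d)"
  by (simp add: rational_ltf_def)

lemma rational_ltf_subset: "rational_ltf d \<subseteq> ltf d"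
  by (auto simp: rational_ltf_def ltf_def)

lemma ltf_values: "h \<in> ltf d \<Longrightarrow> h x = 0 \<or> h x = 1"
  by (auto simp: ltf_def pos_def)

lemma borel_measurable_ltf:
  assumes "h \<in> ltf d"
  shows "h \<in> borel_measurable (\<Pi>\<^sub>M i\<in>{..<d}. borel)"
proof -
  obtain r c where h: "h = (\<lambda>x. pos ((\<Sum>i<d. r i * x i) + c))"
    using assms unfolding ltf_def by blast
  have "(\<lambda>x. (\<Sum>i<d. r i * x i) + c) \<in> borel_measurable (\<Pi>\<^sub>M i\<in>{..<d}. (borel :: real measure))"
    by measurable
  then show ?thesis unfolding h pos_def by measurable
qed

text \<open>The rational coefficients are perturbed on a scale much smaller than the downward shift of the
  threshold, so that points on the boundary of the half-space stay outside.\<close>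

lemma ltf_rational_approximation:
  assumes "h \<in> ltf d"
  shows "\<exists>g. (\<forall>n. g n \<in> rational_ltf d) \<and> (\<forall>x. \<forall>\<^sub>F n in sequentially. g n x = h x)"
proof -
  obtain r c where h: "\<And>x. h x = pos ((\<Sum>i<d. r i * x i) + c)"
    using assms unfolding ltf_def by blast
  define s :: "nat \<Rightarrow> real" where "s n = 1 / (real n + 1)" for n
  have s_pos: "0 < s n" for n by (simp add: s_def)
  have "\<exists>x. \<bar>of_rat x - r i\<bar> \<le> s n * s n" for n i
  proof -
    have "r i < r i + s n * s n" using s_pos[of n] by simp
    then obtain x where "r i < of_rat x" "of_rat x < r i + s n * s n"
      using of_rat_dense by blast
    then show ?thesis by (intro exI[of _ x]) auto
  qed
  then have "\<forall>n i. \<exists>x. \<bar>of_rat x - r i\<bar> \<le> s n * s n" by blast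
  then obtain R where R: "\<And>n i. \<bar>of_rat (R n i) - r i\<bar> \<le> s n * s n"
    by (simp only: choice_iff) blast
  \<comment> \<open>A shift of more than \<open>s n\<close> outweighs a coefficient error of at most
    \<open>s n\<close>, so the value drops strictly, yet by less than
    \<open>3 * s n\<close>.\<close>
  have "\<exists>x. c - 2 * s n < of_rat x \<and> of_rat x < c - s n" for n
    using s_pos[of n] by (intro of_rat_dense) simp
  then obtain C where C: "\<And>n. c - 2 * s n < of_rat (C n)" "\<And>n. of_rat (C n) < c - s n" by metis
  define g where "g n x = pos ((\<Sum>i<d. of_rat (map (R n) [0..<d] ! i) * x i) + of_rat (C n))" for n x
  have "g n \<in> rational_ltf d" for n
    unfolding rational_ltf_def g_def by (intro image_eqI[where x="(map (R n) [0..<d], C n)"]) auto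
  moreover have "\<forall>\<^sub>F n in sequentially. g n x = h x" for x
  proof -
    define u where "u = (\<Sum>i<d. r i * x i) + c"
    define B where "B = (\<Sum>i<d. \<bar>x i\<bar>)"
    have "s = (\<lambda>n. inverse (real (Suc n)))"
      by (simp add: fun_eq_iff s_def inverse_eq_divide add.commute)
    then have s: "s \<longlonglongrightarrow> 0" using LIMSEQ_inverse_real_of_nat by simp
    note lim = tendsto_mult_left_zero[OF s, of B] tendsto_mult_right_zero[OF s, of 3]
    have "\<forall>\<^sub>F n in sequentially. s n * B < 1" using order_tendstoD(2)[OF lim(1)] by simp
    moreover have "\<forall>\<^sub>F n in sequentially. 0 < u \<longrightarrow> 3 * s n < u"
      using order_tendstoD(2)[OF lim(2), of u] by (cases "0 < u") auto
    ultimately show ?thesis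
    proof eventually_elim
      case (elim n)
      let ?v = "(\<Sum>i<d. of_rat (R n i) * x i) + of_rat (C n)"
      have "\<bar>(\<Sum>i<d. of_rat (R n i) * x i) - (\<Sum>i<d. r i * x i)\<bar>
          = \<bar>\<Sum>i<d. (of_rat (R n i) - r i) * x i\<bar>"
        by (simp add: sum_subtractf left_diff_distrib)
      also have "\<dots> \<le> (\<Sum>i<d. \<bar>(of_rat (R n i) - r i) * x i\<bar>)" by (rule sum_abs)
      also have "\<dots> \<le> (\<Sum>i<d. s n * s n * \<bar>x i\<bar>)"
        unfolding abs_mult using R by (intro sum_mono mult_right_mono) auto
      also have "\<dots> = s n * (s n * B)" by (simp add: B_def sum_distrib_left mult.assoc)
      also have "\<dots> \<le> s n * 1" using elim s_pos[of n] by (intro mult_left_mono) auto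
      finally have "\<bar>(\<Sum>i<d. of_rat (R n i) * x i) - (\<Sum>i<d. r i * x i)\<bar> \<le> s n" by simp
      then have "?v < u" "u - 3 * s n < ?v" using C[of n] by (auto simp: u_def)
      then have "0 < ?v \<longleftrightarrow> 0 < u" using elim by linarith
      moreover have "g n x = pos ?v" by (simp add: g_def)
      ultimately show ?case by (simp add: h u_def[symmetric] pos_def)
    qed
  qed
  ultimately show ?thesis by blast
qed

definition bag_error_set where
  "bag_error_set q k B h = {b\<in>space B. (\<Sum>i<q. h (b i)) / real q \<noteq> real k / real q}"

text \<open>Which of the \<open>n\<close> bags are misjudged depends only on the labels of their at
  most \<open>n * q\<close> points, so error patterns are no more numerous than traces on these
  points.\<close>

lemma card_bag_error_traces_le:
  fixes t :: real
  assumes H: "H \<subseteq> ltf d" and t: "0 < t" "t \<le> 1"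
  shows "real (card ((\<lambda>A. {j. j < n \<and> \<omega> j \<in> A}) ` bag_error_set q k B ` H))
    \<le> exp (t * real (n * q)) / t ^ Suc d"
proof -
  define X where "X = (\<lambda>(j, i). \<omega> j i) ` ({..<n} \<times> {..<q})"
  have X: "finite X" "card X \<le> n * q"
    unfolding X_def using card_image_le[of "{..<n} \<times> {..<q}"] by (auto simp: card_cartesian_product)
  let ?tr = "\<lambda>h. {x\<in>X. h x = 1}"
  define \<phi> where "\<phi> Y = {j. j < n \<and> \<omega> j \<in> space B \<and>
      (\<Sum>i<q. if \<omega> j i \<in> Y then 1 else 0) / real q \<noteq> real k / real q}" for Y
  have "{j. j < n \<and> \<omega> j \<in> bag_error_set q k B h} = \<phi> (?tr h)" if "h \<in> H" for h
  proof -
    have "h (\<omega> j i) = (if \<omega> j i \<in> ?tr h then 1 else 0)" if "j < n" "i < q" for i j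
    proof -
      have "\<omega> j i \<in> X" using that by (auto simp: X_def intro!: image_eqI[where x="(j, i)"])
      then show ?thesis using ltf_values[of h d "\<omega> j i"] H \<open>h \<in> H\<close> by auto
    qed
    then have "(\<Sum>i<q. h (\<omega> j i)) = (\<Sum>i<q. if \<omega> j i \<in> ?tr h then 1 else 0)" if "j < n" for j
      using that by (intro sum.cong) auto
    then show ?thesis by (auto simp: \<phi>_def bag_error_set_def)
  qed
  then have "(\<lambda>A. {j. j < n \<and> \<omega> j \<in> A}) ` bag_error_set q k B ` H = \<phi> ` ?tr ` H"
    by (simp add: image_image)
  then have "card ((\<lambda>A. {j. j < n \<and> \<omega> j \<in> A}) ` bag_error_set q k B ` H) \<le> card (?tr ` H)"
    using X finite_subset[of "?tr ` H" "Pow X"] by (auto intro!: card_image_le)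
  also have "\<dots> \<le> card (?tr ` ltf d)" 
    using X H finite_subset[of "?tr ` ltf d" "Pow X"] by (intro card_mono image_mono) auto
  finally show ?thesis using card_ltf_traces_le[OF X t, of d] by linarith
qed

section \<open>Sample size arithmetic\<close>

lemma deviation_bound_arith:
  fixes \<epsilon> \<delta> :: real and d q m :: nat
  assumes d: "1 \<le> d" and q: "2 \<le> q" and \<epsilon>: "0 < \<epsilon>" "\<epsilon> < 1 / (4 * real q)" and \<delta>: "0 < \<delta>" "\<delta> < 1"
    and m: "100 * real d * (ln (real q) + ln (1 / \<delta>)) / \<epsilon>\<^sup>2 \<le> real m"
  defines "t \<equiv> \<epsilon> / (64 * real q)"
  shows "10 \<le> \<epsilon> * real m"
    and "2 * (exp (t * real (2 * m * q)) / t ^ Suc d) * (27/32) powr (\<epsilon> * real m) \<le> \<delta>"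
proof -
  define L where "L = ln (real q) + ln (1 / \<delta>)"
  define u where "u = 1 / \<epsilon>"
  have "ln 2 \<le> ln (real q)" "0 < ln (1 / \<delta>)" using q \<delta> by auto
  then have L: "ln (real q) \<le> L" "ln (1 / \<delta>) \<le> L" "ln 2 \<le> L"
    using ln2_ge_two_thirds unfolding L_def by linarith+
  then have L23: "2/3 \<le> L" using ln2_ge_two_thirds by linarith
  have "4 * real q < u" using \<epsilon> q by (simp add: u_def field_simps)
  then have u: "8 < u" using q by linarith
  \<comment> \<open>Everything is reduced to linear inequalities in \<open>d * L\<close> and
    \<open>d * L * u\<close>; \<open>u > 8\<close> absorbs the former into the latter.\<close>
  have ut: "real d * L \<le> real d * L * u / 8"
    using mult_left_mono[of 8 u "real d * L"] u L23 by simp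
  have dL: "2/3 \<le> real d * L" using mult_mono[of 1 "real d" "2/3" L] d L23 by simp
  have em: "100 * (real d * L * u) \<le> \<epsilon> * real m"
    using m \<epsilon> by (simp add: L_def u_def power2_eq_square field_simps)
  have "10 \<le> 100 * (real d * L * u)" using ut dL by linarith
  then show "10 \<le> \<epsilon> * real m" using em by linarith
  have t: "0 < t" using \<epsilon> q by (simp add: t_def)
  \<comment> \<open>Here 64 is \<open>2 ^ 6\<close>. The crude bound \<open>ln u \<le> u\<close> is
    affordable because \<open>\<epsilon> * m\<close> is at least
    \<open>100 * d * L * u\<close>.\<close>
  have lnt: "- ln t \<le> 6 * L + L + 2 * (L * u)"
  proof -
    have "- ln t = ln (64 * real q * u)"
      using \<epsilon> q by (simp add: t_def u_def ln_div ln_mult)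
    also have "\<dots> = 6 * ln 2 + ln (real q) + ln u"
      using u q ln_realpow[of "2::real" 6] by (simp add: ln_mult)
    finally have "- ln t = 6 * ln 2 + ln (real q) + ln u" .
    moreover have "ln u \<le> u" using u ln_le_minus_one[of u] by simp
    moreover have "u \<le> 2 * (L * u)" using u L23 mult_right_mono[of "2/3" L u] by simp
    ultimately show ?thesis using L by linarith
  qed
  have "\<epsilon> < 1" using u \<epsilon> by (simp add: u_def field_simps)
  then have "t \<le> 1" using q by (simp add: t_def field_simps)
  then have "real (Suc d) * (- ln t) \<le> (2 * real d) * (6 * L + L + 2 * (L * u))"
    using lnt d t by (intro mult_mono) auto
  also have "\<dots> = 14 * (real d * L) + 4 * (real d * L * u)" by (simp add: algebra_simps)
  finally have e1: "real (Suc d) * (- ln t) \<le> 14 * (real d * L) + 4 * (real d * L * u)" .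
  have "1 * L \<le> real d * L" using d L23 by (intro mult_right_mono) auto
  then have e2: "ln 2 + ln (1 / \<delta>) \<le> 2 * (real d * L)" using L by linarith
  \<comment> \<open>The swaps gain \<open>5/32\<close> of \<open>\<epsilon> * m\<close> and the
    choice of \<open>t\<close> spends \<open>1/32\<close>. The remaining eighth is at least
    \<open>12.5 * d * L * u\<close>, while the other costs stay below
    \<open>6 * d * L * u\<close>.\<close>
  have exponent: "ln 2 + \<epsilon> * real m / 32 + real (Suc d) * (- ln t) - 5/32 * (\<epsilon> * real m) \<le> - ln (1 / \<delta>)"
    using e1 e2 em ut dL by linarith
  have powr_le: "(27/32::real) powr (\<epsilon> * real m) \<le> exp (- (5/32 * (\<epsilon> * real m)))"
  proof -
    have "\<epsilon> * real m * ln (27/32) \<le> \<epsilon> * real m * (- 5/32)"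
      using ln_le_minus_one[of "27/32"] \<epsilon> by (intro mult_left_mono) auto
    then show ?thesis by (simp add: powr_def)
  qed
  have K_eq: "exp (t * real (2 * m * q)) / t ^ Suc d = exp (\<epsilon> * real m / 32) * exp (real (Suc d) * (- ln t))"
  proof -
    have "t ^ Suc d = exp (ln t) ^ Suc d" using t by simp
    also have "\<dots> = exp (real (Suc d) * ln t)" by (simp only: exp_of_nat_mult)
    finally have "1 / t ^ Suc d = exp (real (Suc d) * (- ln t))"
      by (simp only: exp_minus divide_inverse mult_minus_right mult_1)
    moreover have "t * real (2 * m * q) = \<epsilon> * real m / 32" using q by (simp add: t_def)
    ultimately show ?thesis by (metis times_divide_eq_right mult.right_neutral)
  qed
  have "2 * (exp (t * real (2 * m * q)) / t ^ Suc d) * (27/32) powr (\<epsilon> * real m)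
      \<le> 2 * (exp (\<epsilon> * real m / 32) * exp (real (Suc d) * (- ln t))) * exp (- (5/32 * (\<epsilon> * real m)))"
    unfolding K_eq using powr_le by (intro mult_left_mono) auto
  also have "\<dots> = exp (ln 2 + \<epsilon> * real m / 32 + real (Suc d) * (- ln t) - 5/32 * (\<epsilon> * real m))"
    by (simp only: exp_add exp_diff exp_minus exp_ln zero_less_numeral divide_inverse mult.assoc)
  also have "\<dots> \<le> exp (- ln (1 / \<delta>))" using exponent by (simp only: exp_le_cancel_iff)
  also have "\<dots> = \<delta>" using \<delta> by (simp add: ln_div)
  finally show "2 * (exp (t * real (2 * m * q)) / t ^ Suc d) * (27/32) powr (\<epsilon> * real m) \<le> \<delta>" .
qed

section \<open>Bags drawn for a fixed target function\<close>

context
  fixes d :: nat and D :: "(nat \<Rightarrow> real) measure" and f q k B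
  assumes D: "prob_space D" "sets D = sets (\<Pi>\<^sub>M i\<in>{..<d}. (borel :: real measure))"
    and f: "f \<in> ltf d" "0 < measure D {x\<in>space D. f x = 1}" "0 < measure D {x\<in>space D. f x = 0}"
    and k: "1 \<le> k" "k < q"
  defines "B \<equiv> bag_dist D f q k"
begin

interpretation D: prob_space D by (rule D)

lemma borel_measurable_ltf_D:
  assumes "h \<in> ltf d" shows "h \<in> borel_measurable D"
  using borel_measurable_ltf[OF assms] D(2) by (simp cong: measurable_cong_sets)

lemma ltf_sets [measurable]:
  assumes "h \<in> ltf d" shows "{x\<in>space D. h x = a} \<in> sets D"
  using borel_measurable_ltf_D[OF assms] by measurable

lemma sets_cond_dist: "sets (cond_dist D f a) = sets D"
  by (simp add: cond_dist_def)

lemma space_cond_dist: "space (cond_dist D f a) = space D"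
  by (simp add: cond_dist_def)

lemma prob_space_cond_dist:
  assumes "a = 0 \<or> a = 1" shows "prob_space (cond_dist D f a)"
  unfolding cond_dist_def
  by (rule prob_space_uniform_measure) (use f assms in \<open>auto simp: D.emeasure_eq_measure\<close>)

lemma measure_cond_dist:
  assumes "a = 0 \<or> a = 1" and A: "A \<in> sets D"
  shows "measure D {x\<in>space D. f x = a} * measure (cond_dist D f a) A = measure D ({x\<in>space D. f x = a} \<inter> A)"
  unfolding cond_dist_def
  by (subst measure_uniform_measure) (use f assms in \<open>auto simp: D.emeasure_eq_measure\<close>)

lemma bag_components: "prob_space (if i < k then cond_dist D f 1 else cond_dist D f 0)"
  using prob_space_cond_dist by auto

lemma prob_space_bag: "prob_space B"
  unfolding B_def bag_dist_def by (rule prob_space_PiM) (rule bag_components)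

lemma bag_error_set_measurable:
  assumes h: "h \<in> ltf d" shows "bag_error_set q k B h \<in> sets B"
proof -
  have "(\<lambda>b. h (b i)) \<in> borel_measurable B" if "i < q" for i
  proof (rule measurable_compose[of "\<lambda>b. b i" B D])
    have "(\<lambda>b. b i) \<in> measurable B (if i < k then cond_dist D f 1 else cond_dist D f 0)"
      unfolding B_def bag_dist_def using that by (intro measurable_component_singleton) simp
    then show "(\<lambda>b. b i) \<in> measurable B D"
      by (simp add: measurable_def sets_cond_dist space_cond_dist split: if_splits)
  qed (rule borel_measurable_ltf_D[OF h])
  then have "(\<lambda>b. (\<Sum>i<q. h (b i)) / real q) \<in> borel_measurable B"
    by (intro borel_measurable_divide borel_measurable_sum) auto
  then show ?thesis unfolding bag_error_set_def by measurable
qed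

lemma disagreement_measure_le:
  assumes g: "g \<in> ltf d \<or> (\<exists>g'\<in>ltf d. g = (\<lambda>x. 1 - g' x))"
    and 1: "measure (cond_dist D f 1) {x\<in>space D. g x = 0} \<le> \<eta>"
    and 0: "measure (cond_dist D f 0) {x\<in>space D. g x = 1} \<le> \<eta>"
  shows "measure D {x\<in>space D. f x \<noteq> g x} \<le> \<eta>"
proof -
  have g01: "g x = 0 \<or> g x = 1" for x using g ltf_values by fastforce
  have g_sets: "{x\<in>space D. g x = a} \<in> sets D" for a
    using g
  proof
    assume "\<exists>g'\<in>ltf d. g = (\<lambda>x. 1 - g' x)"
    then obtain g' where "g' \<in> ltf d" "g = (\<lambda>x. 1 - g' x)" by blast
    moreover have "1 - y = a \<longleftrightarrow> y = 1 - a" for y by auto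
    ultimately show ?thesis using ltf_sets[of g' "1 - a"] by simp
  qed (rule ltf_sets)
  let ?F = "\<lambda>a. {x\<in>space D. f x = a}"
  have F: "?F a \<in> sets D" for a using f by simp
  have "{x\<in>space D. f x \<noteq> g x} = ?F 1 \<inter> {x\<in>space D. g x = 0} \<union> ?F 0 \<inter> {x\<in>space D. g x = 1}"
    using g01 ltf_values[OF f(1)] by force
  then have "measure D {x\<in>space D. f x \<noteq> g x}
      \<le> measure D (?F 1 \<inter> {x\<in>space D. g x = 0}) + measure D (?F 0 \<inter> {x\<in>space D. g x = 1})"
    using F g_sets by (simp add: measure_Un_le)
  also have "\<dots> = measure D (?F 1) * measure (cond_dist D f 1) {x\<in>space D. g x = 0}
      + measure D (?F 0) * measure (cond_dist D f 0) {x\<in>space D. g x = 1}"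
    using g_sets by (simp add: measure_cond_dist)
  also have "\<dots> \<le> measure D (?F 1) * \<eta> + measure D (?F 0) * \<eta>"
    using 1 0 by (intro add_mono mult_left_mono) auto
  also have "\<dots> = (measure D (?F 1) + measure D (?F 0)) * \<eta>" by (simp add: distrib_right)
  also have "measure D (?F 1) + measure D (?F 0) = measure D (?F 1 \<union> ?F 0)"
    using F by (intro D.finite_measure_Union[symmetric]) auto
  also have "?F 1 \<union> ?F 0 = space D" using ltf_values[OF f(1)] by auto
  finally show ?thesis by (simp add: D.prob_space)
qed

lemma small_bag_error_imp_small_disagreement:
  assumes h: "h \<in> ltf d" and err: "measure B (bag_error_set q k B h) \<le> \<eta>" and \<eta>: "\<eta> < 1/2"
  shows "measure D {x\<in>space D. f x \<noteq> h x} \<le> \<eta>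
    \<or> 2 * k = q \<and> measure D {x\<in>space D. f x \<noteq> 1 - h x} \<le> \<eta>"
proof -
  interpret B: prob_space B by (rule prob_space_bag)
  let ?P = "cond_dist D f 1" and ?Q = "cond_dist D f 0"
  interpret P: prob_space ?P by (rule prob_space_cond_dist) simp
  interpret Q: prob_space ?Q by (rule prob_space_cond_dist) simp
  let ?X = "{x\<in>space D. h x = 0}" and ?Y = "{x\<in>space D. h x = 1}"
  let ?p = "measure ?P ?X" and ?r = "measure ?Q ?Y"
  have XY: "?X \<in> sets D" "?Y \<in> sets D" using h by auto
  let ?G = "{b\<in>space B. card {i\<in>{..<k}. b i \<in> ?X} = card {i\<in>{k..<q}. b i \<in> ?Y}}"
  have count: "(\<Sum>i\<in>J. if Z i then 1 else 0) = real (card {i\<in>J. Z i})" if "finite J" for J Z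
    using that by (simp add: sum.If_cases Collect_conj_eq)
  \<comment> \<open>The labels in a bag sum to \<open>k\<close> minus the missed positives plus the
    false positives, so a correct average means that the two error counts agree.\<close>
  have "space B - bag_error_set q k B h \<subseteq> ?G"
  proof
    fix b assume "b \<in> space B - bag_error_set q k B h"
    then have b: "b \<in> space B" "(\<Sum>i<q. h (b i)) = real k"
      using k by (auto simp: bag_error_set_def)
    have bD: "b i \<in> space D" if "i < q" for i
      using b(1) that by (auto simp: B_def bag_dist_def space_PiM PiE_iff space_cond_dist split: if_splits)
    have "(\<Sum>i<q. h (b i)) = (\<Sum>i<k. h (b i)) + (\<Sum>i\<in>{k..<q}. h (b i))"
      using k by (subst sum.union_disjoint[symmetric]) (auto intro!: sum.cong)
    also have "(\<Sum>i<k. h (b i)) = (\<Sum>i<k. 1 - (if b i \<in> ?X then 1 else 0))"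
      using ltf_values[OF h] bD k by (intro sum.cong) force+
    also have "\<dots> = real k - real (card {i\<in>{..<k}. b i \<in> ?X})"
      by (subst sum_subtractf, subst count) auto
    also have "(\<Sum>i\<in>{k..<q}. h (b i)) = (\<Sum>i\<in>{k..<q}. if b i \<in> ?Y then 1 else 0)"
      using ltf_values[OF h] bD by (intro sum.cong) force+
    also have "\<dots> = real (card {i\<in>{k..<q}. b i \<in> ?Y})"
      by (rule count) simp
    finally show "b \<in> ?G" using b by simp
  qed
  moreover have "?G \<in> sets B"
  proof -
    have "(\<lambda>b. real (card {i\<in>{..<k}. b i \<in> ?X})) \<in> borel_measurable B"
      "(\<lambda>b. real (card {i\<in>{k..<q}. b i \<in> ?Y})) \<in> borel_measurable B"
      unfolding B_def bag_dist_def using XY k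
      by (intro borel_measurable_card_hits; auto simp: sets_cond_dist)+
    then have "{b\<in>space B. real (card {i\<in>{..<k}. b i \<in> ?X}) = real (card {i\<in>{k..<q}. b i \<in> ?Y})} \<in> sets B"
      by measurable
    then show ?thesis by (simp only: of_nat_eq_iff)
  qed
  ultimately have "1 - \<eta> \<le> measure B ?G"
    using B.finite_measure_mono[of "space B - bag_error_set q k B h" ?G]
      B.prob_compl[OF bag_error_set_measurable[OF h]] err by linarith
  also have "\<dots> \<le> (\<Sum>a\<le>k. binom_prob k ?p a * binom_prob (q - k) ?r a)"
    unfolding B_def bag_dist_def using k XY
    by (intro prob_equal_hits_le) (auto simp: sets_cond_dist P.prob_space_axioms Q.prob_space_axioms)
  finally have "?p \<le> \<eta> \<and> ?r \<le> \<eta> \<or> k = q - k \<and> 1 - ?p \<le> \<eta> \<and> 1 - ?r \<le> \<eta>"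
    using k \<eta> by (intro binom_prob_agreement) auto
  then show ?thesis
  proof
    assume "?p \<le> \<eta> \<and> ?r \<le> \<eta>"
    then show ?thesis using disagreement_measure_le[of h] h by auto
  next
    \<comment> \<open>Here \<open>h\<close> errs on almost every point of both classes, so its
      complement has conditional errors \<open>1 - ?p\<close> and \<open>1 - ?r\<close>.\<close>
    assume *: "k = q - k \<and> 1 - ?p \<le> \<eta> \<and> 1 - ?r \<le> \<eta>"
    have "{x\<in>space D. 1 - h x = 0} = space ?P - ?X" "{x\<in>space D. 1 - h x = 1} = space ?Q - ?Y"
      using ltf_values[OF h] by (force simp: space_cond_dist)+
    then have "measure ?P {x\<in>space D. 1 - h x = 0} = 1 - ?p" "measure ?Q {x\<in>space D. 1 - h x = 1} = 1 - ?r"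
      using XY P.prob_compl[of ?X] Q.prob_compl[of ?Y] by (simp_all add: sets_cond_dist)
    then have "measure D {x\<in>space D. f x \<noteq> 1 - h x} \<le> \<eta>"
      using * h by (intro disagreement_measure_le[of "\<lambda>x. 1 - h x"]) auto
    then show ?thesis using * k by auto
  qed
qed

text \<open>A bag has finitely many points, so the error indicators are eventually equal at each
  bag, and dominated convergence applies.\<close>

lemma measure_bag_error_tendsto:
  assumes h: "h \<in> ltf d" "\<And>n. g n \<in> ltf d" and lim: "\<And>x. \<forall>\<^sub>F n in sequentially. g n x = h x"
  shows "(\<lambda>n. measure B (bag_error_set q k B (g n))) \<longlonglongrightarrow> measure B (bag_error_set q k B h)"
proof -
  interpret B: prob_space B by (rule prob_space_bag)
  let ?A = "bag_error_set q k B"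
  have "(\<lambda>n. \<integral>b. indicator (?A (g n)) b \<partial>B) \<longlonglongrightarrow> (\<integral>b. indicator (?A h) b \<partial>B :: real)"
  proof (rule integral_dominated_convergence[where w="\<lambda>_. 1"])
    have "(\<lambda>n. indicator (?A (g n)) b :: real) \<longlonglongrightarrow> indicator (?A h) b" for b
    proof (rule tendsto_eventually)
      have "\<forall>\<^sub>F n in sequentially. \<forall>i\<in>{..<q}. g n (b i) = h (b i)"
        using lim by (intro eventually_ball_finite) auto
      then show "\<forall>\<^sub>F n in sequentially. indicator (?A (g n)) b = (indicator (?A h) b :: real)"
        by eventually_elim (simp add: indicator_def bag_error_set_def)
    qed
    then show "AE b in B. (\<lambda>n. indicator (?A (g n)) b :: real) \<longlonglongrightarrow> indicator (?A h) b" by simp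
  qed (use h bag_error_set_measurable in \<open>auto simp: indicator_def\<close>)
  then show ?thesis using h bag_error_set_measurable by simp
qed

text \<open>The deviation bound is applied to the countable rational family; approximation then
  extends it to all threshold functions outside the same bad event.\<close>

lemma uniform_bag_error_bound:
  fixes \<epsilon> \<delta> :: real and m :: nat
  assumes \<epsilon>: "0 < \<epsilon>" "\<epsilon> < 1 / (4 * real q)" and \<delta>: "0 < \<delta>" "\<delta> < 1" and d: "1 \<le> d"
    and m: "100 * real d * (ln (real q) + ln (1 / \<delta>)) / \<epsilon>\<^sup>2 \<le> real m"
  shows "\<exists>E\<in>sets (sample_dist D f q k m). 1 - \<delta> \<le> measure (sample_dist D f q k m) E
    \<and> (\<forall>M\<in>E. \<forall>h\<in>ltf d. bag_err q k m h M \<le> \<epsilon> \<longrightarrow> measure B (bag_error_set q k B h) \<le> 4 * \<epsilon>)"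
proof -
  interpret B: prob_space B by (rule prob_space_bag)
  let ?S = "sample_dist D f q k m" and ?A = "bag_error_set q k B"
  have S: "?S = Pi\<^sub>M {..<m} (\<lambda>_. B)" by (simp add: sample_dist_def B_def)
  interpret S: prob_space ?S unfolding S by (rule prob_space_PiM) (rule prob_space_bag)
  define t where "t = \<epsilon> / (64 * real q)"
  have q: "2 \<le> q" using k by simp
  have "1 / (4 * real q) \<le> 1" using q by simp
  then have "\<epsilon> < 1" using \<epsilon> by linarith
  then have t: "0 < t" "t \<le> 1" using \<epsilon> q by (auto simp: t_def field_simps)
  note arith = deviation_bound_arith[OF d q \<epsilon> \<delta> m, folded t_def]
  define Bad where "Bad = {\<omega>\<in>space ?S. \<exists>A\<in>?A ` rational_ltf d. 4 * \<epsilon> < measure B A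
      \<and> real (card {j\<in>{..<m}. \<omega> j \<in> A}) \<le> \<epsilon> * real m}"
  have A_sets: "?A ` rational_ltf d \<subseteq> sets B"
    using rational_ltf_subset bag_error_set_measurable by blast
  have A_countable: "countable (?A ` rational_ltf d)"
    using countable_rational_ltf by (rule countable_image)
  have Bad: "Bad \<in> sets ?S" "measure ?S Bad \<le> 2 * (exp (t * real (2 * m * q)) / t ^ Suc d) * (27/32) powr (\<epsilon> * real m)"
    unfolding Bad_def S
    using B.relative_uniform_deviation[OF A_countable A_sets arith(1)
        card_bag_error_traces_le[OF rational_ltf_subset t]] by simp_all
  have "measure B (?A h) \<le> 4 * \<epsilon>" if M: "M \<in> space ?S - Bad" and h: "h \<in> ltf d" and err: "bag_err q k m h M \<le> \<epsilon>" for M h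
  proof -
    obtain g where g: "\<And>n. g n \<in> rational_ltf d" "\<And>x. \<forall>\<^sub>F n in sequentially. g n x = h x"
      using ltf_rational_approximation[OF h] by blast
    have g_ltf: "g n \<in> ltf d" for n using g(1) rational_ltf_subset by blast
    have MB: "M j \<in> space B" if "j < m" for j using M that by (auto simp: S space_PiM)
    have "0 < m" using arith(1) by (cases m) auto
    then have h_err: "real (card {j\<in>{..<m}. M j \<in> ?A h}) \<le> \<epsilon> * real m"
    proof -
      have "{j\<in>{..<m}. M j \<in> ?A h} = {j\<in>{..<m}. (\<Sum>i<q. h (M j i)) / real q \<noteq> real k / real q}"
        using MB by (auto simp: bag_error_set_def)
      then show ?thesis using err \<open>0 < m\<close> by (simp add: bag_err_def field_simps)
    qed
    \<comment> \<open>On the finitely many sample points the approximants eventually coincide with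
      \<open>h\<close>. They then share its sample error, so their true errors are at most
      \<open>4 * \<epsilon>\<close>, and so is the limit.\<close>
    have "\<forall>\<^sub>F n in sequentially. \<forall>j\<in>{..<m}. \<forall>i\<in>{..<q}. g n (M j i) = h (M j i)"
      using g(2) by (intro eventually_ball_finite ballI) auto
    then have "\<forall>\<^sub>F n in sequentially. measure B (?A (g n)) \<le> 4 * \<epsilon>"
    proof eventually_elim
      case (elim n)
      then have "{j\<in>{..<m}. M j \<in> ?A (g n)} = {j\<in>{..<m}. M j \<in> ?A h}"
        by (auto simp: bag_error_set_def)
      then show ?case using M h_err g(1)[of n] by (auto simp: Bad_def not_less)
    qed
    then show ?thesis
      by (intro tendsto_upperbound[OF measure_bag_error_tendsto[OF h g_ltf g(2)]]) auto
  qed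
  moreover have "1 - \<delta> \<le> measure ?S (space ?S - Bad)"
    using S.prob_compl[OF Bad(1)] Bad(2) arith(2) by linarith
  ultimately show ?thesis using Bad(1) by (intro bexI[of _ "space ?S - Bad"]) auto
qed

end

theorem theorem4:
  shows "\<exists>C0::real. C0 > 0 \<and>
   (\<forall>(d::nat) (D::(nat \<Rightarrow> real) measure) f (q::nat) (k::nat) (\<epsilon>::real) (\<delta>::real) (m::nat).
      prob_space D \<longrightarrow>
      sets D = sets (\<Pi>\<^sub>M i\<in>{..<d}. (borel :: real measure)) \<longrightarrow>
      f \<in> ltf d \<longrightarrow>
      measure D {x \<in> space D. f x = 1} > 0 \<longrightarrow>
      measure D {x \<in> space D. f x = 0} > 0 \<longrightarrow>
      q \<ge> 2 \<longrightarrow> 1 \<le> k \<longrightarrow> k \<le> q - 1 \<longrightarrow>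
      0 < \<epsilon> \<longrightarrow> \<epsilon> < 1 / (4 * real q) \<longrightarrow> \<delta> > 0 \<longrightarrow>
      real m \<ge> C0 * real d * (ln (real q) + ln (1 / \<delta>)) / \<epsilon>\<^sup>2 \<longrightarrow>
      (\<exists>E \<in> sets (sample_dist D f q k m).
         measure (sample_dist D f q k m) E \<ge> 1 - \<delta> \<and>
         (\<forall>M \<in> E. \<forall>h \<in> ltf d. bag_err q k m h M \<le> \<epsilon> \<longrightarrow>
            ((real k \<noteq> real q / 2 \<longrightarrow>
                measure D {x \<in> space D. f x \<noteq> h x} \<le> 4 * \<epsilon>) \<and>
             (real k = real q / 2 \<longrightarrow>
                measure D {x \<in> space D. f x \<noteq> h x} \<le> 4 * \<epsilon> \<or>
                measure D {x \<in> space D. f x \<noteq> 1 - h x} \<le> 4 * \<epsilon>)))))"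
proof (rule exI[of _ 100], rule conjI, simp, intro allI impI, goal_cases)
  case (1 d D f q k \<epsilon> \<delta> m)
  note D = 1(1,2) and f = 1(3,4,5) and q = 1(6) and k = 1(7,8) and \<epsilon> = 1(9,10) and \<delta> = 1(11) and m = 1(12)
  have kq: "k < q" using k q by simp
  show ?case
  proof (cases "\<delta> < 1")
    case False
    \<comment> \<open>For \<open>\<delta> \<ge> 1\<close> the required probability is not positive,
      so the empty event suffices.\<close>
    then show ?thesis by (intro bexI[of _ "{}"]) auto
  next
    case True
    have d: "1 \<le> d"
    \<comment> \<open>In dimension 0 every threshold function is constant, but \<open>f\<close>
      takes both values with positive probability.\<close>
    proof (rule ccontr)
      assume "\<not> 1 \<le> d"
      then have "d = 0" by simp
      then obtain c where "f = (\<lambda>x. pos c)" using f(1) by (auto simp: ltf_def fun_eq_iff)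
      then show False using f(2,3) by (cases "pos c = 1") auto
    qed
    have "4 * \<epsilon> < 1/2"
    proof -
      \<comment> \<open>The hypothesis on \<open>\<epsilon>\<close> keeps the true bag error
        \<open>4 * \<epsilon>\<close> below one half, as the agreement argument demands.\<close>
      have "1 / (4 * real q) \<le> 1 / (4 * 2)" using q by (intro divide_left_mono) auto
      then show ?thesis using \<epsilon> by linarith
    qed
    note small = small_bag_error_imp_small_disagreement[OF D f k(1) kq _ _ this]
    obtain E where E: "E \<in> sets (sample_dist D f q k m)" "1 - \<delta> \<le> measure (sample_dist D f q k m) E"
      and E_err: "\<And>M h. M \<in> E \<Longrightarrow> h \<in> ltf d \<Longrightarrow> bag_err q k m h M \<le> \<epsilon> \<Longrightarrow>
        measure (bag_dist D f q k) (bag_error_set q k (bag_dist D f q k) h) \<le> 4 * \<epsilon>"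
      using uniform_bag_error_bound[OF D f k(1) kq \<epsilon> \<delta> True d m] by blast
    show ?thesis
    proof (rule bexI[OF _ E(1)], intro conjI ballI impI)
      fix M h assume M: "M \<in> E" "h \<in> ltf d" "bag_err q k m h M \<le> \<epsilon>"
      note * = small[OF M(2) E_err[OF M]]
      show "measure D {x \<in> space D. f x \<noteq> h x} \<le> 4 * \<epsilon>" if "real k \<noteq> real q / 2"
        using * that by auto
      show "measure D {x \<in> space D. f x \<noteq> h x} \<le> 4 * \<epsilon> \<or> measure D {x \<in> space D. f x \<noteq> 1 - h x} \<le> 4 * \<epsilon>"
        using * by blast
    qed (rule E(2))
  qed
qed

end
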